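(* Let $T$ be a nullhomologous Lagrangian torus in the symplectic $4$-manifold $X$. Then the Lagrangian framing invariant $\lambda(T)$ is a symplectomorphism invariant of $(X,T)$; that is, if $f\colon X\to Y$ is a symplectomorphism of symplectic $4$-manifolds with $f(T)=T'$, then $\lambda(T)=\lambda(T')$.
   Context: Framings: let $T$ be an embedded torus with tubular neighborhood $N_T$ in a smooth $4$-manifold $X$. A framing of $T$ is a diffeomorphism $\varphi\colon T\times D^2\to N_T$ with $\varphi(p,0)=p$ for all $p\in T$. If $T$ is nullhomologous in $X$, the framing is nullhomologous if for $x\in\partial D^2$ the class $\varphi_*[T\times\{x\}]$ lies in the kernel of $i_*\colon H_2(\partial N_T)\to H_2(X\setminus N_T)$; $\varphi_N$ denotes such a nullhomologous framing (the paper treats it as being determined up to homotopy). Difference class: a framing $\varphi$ gives the section $\sigma(\varphi)(x)=\varphi(x,1)$ of $\partial N_T\to T$. For framings $\varphi_0,\varphi_1$, the difference class $\delta(\varphi_0,\varphi_1)\in H^1(T;\mathbf Z)\cong[T,S^1]$ is the homotopy class of the composition $T\xrightarrow{\sigma(\varphi_1)}\partial N_T\xrightarrow{\varphi_0^{-1}}T\times\partial D^2\xrightarrow{\mathrm{pr}_2}\partial D^2\cong S^1$. Lagrangian framing: if $T$ is Lagrangian in a symplectic $4$-manifold, then by the Lagrangian neighborhood theorem small tubular neighborhoods $N_T$ have, up to symplectic isotopy, a preferred framing $\varphi_L\colon T\times D^2\to N_T$ such that $\varphi_L(T\times\{x\})$ is Lagrangian for every $x\in D^2$ (coming from the identification of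 $N_T$ with a neighborhood of the zero section of $T^*T$). Lagrangian framing invariant: for a nullhomologous Lagrangian torus $T$, $\lambda(T)$ is the nonnegative integer such that the homomorphism $\delta(\varphi_N,\varphi_L)_*\colon H_1(T;\mathbf Z)\to H_1(S^1)=\mathbf Z$ has image $\lambda(T)\,\mathbf Z$; i.e. $\lambda(T)=\gcd(|\delta(\varphi_N,\varphi_L)(a)|,|\delta(\varphi_N,\varphi_L)(b)|)$ for any basis $a,b$ of $H_1(T;\mathbf Z)$. *)

theory Defs
  imports "HOL-Analysis.Analysis" "HOL-Homology.Homology"
begin

section \<open>Smooth maps between open subsets of Euclidean spaces\<close>

primrec Ck_on :: "nat \<Rightarrow> 'e::euclidean_space set \<Rightarrow> ('e \<Rightarrow> 'f::euclidean_space) \<Rightarrow> bool" where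
  "Ck_on 0 S f \<longleftrightarrow> continuous_on S f"
| "Ck_on (Suc k) S f \<longleftrightarrow>
     (\<forall>x\<in>S. f differentiable (at x)) \<and> (\<forall>v. Ck_on k S (\<lambda>x. frechet_derivative f (at x) v))"

definition smooth_on :: "'e::euclidean_space set \<Rightarrow> ('e \<Rightarrow> 'f::euclidean_space) \<Rightarrow> bool" where
  "smooth_on S f \<longleftrightarrow> open S \<and> (\<forall>k. Ck_on k S f)"


section \<open>Smooth manifolds\<close>

text \<open>A chart is a pair of an open domain and a map to the model space; only its values on the
  domain matter. Manifolds have no boundary, need not be compact or connected, and have dimension
  \<open>DIM('e)\<close>. The atlas is not required to be maximal.\<close>

type_synonym ('a, 'e) chart = "'a set \<times> ('a \<Rightarrow> 'e)"

record ('a, 'e) manifold =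
  mtop :: "'a topology"
  atlas :: "('a, 'e) chart set"

definition smooth_manifold :: "('a, 'e::euclidean_space) manifold \<Rightarrow> bool" where
  "smooth_manifold M \<longleftrightarrow>
     Hausdorff_space (mtop M) \<and> second_countable (mtop M) \<and>
     (\<forall>(U, h) \<in> atlas M. openin (mtop M) U \<and> open (h ` U) \<and>
        homeomorphic_map (subtopology (mtop M) U) (top_of_set (h ` U)) h) \<and>
     (\<Union>(U, h) \<in> atlas M. U) = topspace (mtop M) \<and>
     (\<forall>(U, h) \<in> atlas M. \<forall>(V, k) \<in> atlas M. smooth_on (h ` (U \<inter> V)) (k \<circ> inv_into U h))"

definition euclidean_manifold :: "('e::euclidean_space, 'e) manifold" where
  "euclidean_manifold = \<lparr>mtop = euclidean, atlas = {(UNIV, id)}\<rparr>"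

definition product_manifold ::
  "('a, 'e::euclidean_space) manifold \<Rightarrow> ('b, 'f::euclidean_space) manifold \<Rightarrow>
   ('a \<times> 'b, 'e \<times> 'f) manifold" where
  "product_manifold M N =
     \<lparr>mtop = prod_topology (mtop M) (mtop N),
      atlas = {(U \<times> V, map_prod h k) | U h V k. (U, h) \<in> atlas M \<and> (V, k) \<in> atlas N}\<rparr>"

definition smooth_map_open ::
  "('a, 'e::euclidean_space) manifold \<Rightarrow> ('b, 'f::euclidean_space) manifold \<Rightarrow>
   'a set \<Rightarrow> ('a \<Rightarrow> 'b) \<Rightarrow> bool" where
  "smooth_map_open M N W F \<longleftrightarrow>
     openin (mtop M) W \<and> continuous_map (subtopology (mtop M) W) (mtop N) F \<and>
     (\<forall>(U, h) \<in> atlas M. \<forall>(V, k) \<in> atlas N.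
        smooth_on (h ` {p \<in> W \<inter> U. F p \<in> V}) (k \<circ> F \<circ> inv_into U h))"

text \<open>Smoothness of a map between arbitrary subsets of manifolds means that it extends locally to
  a smooth map of open sets. For embedded submanifolds, with or without boundary, this agrees with
  smoothness for the induced smooth structure; for instance the circle, the torus and
  \<open>T \<times> cball 0 1\<close> are treated in this way.\<close>

definition smooth_between ::
  "('a, 'e::euclidean_space) manifold \<Rightarrow> 'a set \<Rightarrow> ('b, 'f::euclidean_space) manifold \<Rightarrow> 'b set \<Rightarrow>
   ('a \<Rightarrow> 'b) \<Rightarrow> bool" where
  "smooth_between M S N R f \<longleftrightarrow>
     f ` S \<subseteq> R \<and>
     (\<forall>p\<in>S. \<exists>W F. p \<in> W \<and> smooth_map_open M N W F \<and> (\<forall>q \<in> S \<inter> W. F q = f q))"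

definition diffeo_between ::
  "('a, 'e::euclidean_space) manifold \<Rightarrow> 'a set \<Rightarrow> ('b, 'f::euclidean_space) manifold \<Rightarrow> 'b set \<Rightarrow>
   ('a \<Rightarrow> 'b) \<Rightarrow> bool" where
  "diffeo_between M S N R f \<longleftrightarrow>
     bij_betw f S R \<and> smooth_between M S N R f \<and> smooth_between N R M S (inv_into S f)"

definition embedded_torus :: "('a, 'e::euclidean_space) manifold \<Rightarrow> 'a set \<Rightarrow> bool" where
  "embedded_torus M T \<longleftrightarrow>
     T \<subseteq> topspace (mtop M) \<and>
     (\<exists>\<iota>. diffeo_between (euclidean_manifold :: (complex \<times> complex, _) manifold)
            (sphere 0 1 \<times> sphere 0 1) M T \<iota>)"

text \<open>Coordinate expressions in the chart \<open>(U, h)\<close> of the vectors at \<open>p\<close> tangent to the subset \<open>S\<close>,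
  as velocities of smooth curves in \<open>S\<close>.\<close>

definition tangent_vectors ::
  "('a, 'e::euclidean_space) manifold \<Rightarrow> ('a, 'e) chart \<Rightarrow> 'a set \<Rightarrow> 'a \<Rightarrow> 'e set" where
  "tangent_vectors M c S p =
     {v. \<exists>\<gamma> \<epsilon>. \<epsilon> > 0 \<and> smooth_between (euclidean_manifold :: (real, _) manifold) {-\<epsilon><..<\<epsilon>} M S \<gamma> \<and>
           \<gamma> 0 = p \<and> ((snd c \<circ> \<gamma>) has_vector_derivative v) (at 0)}"


section \<open>Symplectic manifolds\<close>

text \<open>A differential 2-form is given by its coordinate expressions, one for each chart of the
  atlas: \<open>\<omega> (U, h) x u v\<close> is the value at the point with coordinates \<open>x \<in> h ` U\<close> on the tangent
  vectors with components \<open>u\<close> and \<open>v\<close>.\<close>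

type_synonym ('a, 'e) form2 = "('a, 'e) chart \<Rightarrow> 'e \<Rightarrow> 'e \<Rightarrow> 'e \<Rightarrow> real"

definition two_form :: "('a, 'e::euclidean_space) manifold \<Rightarrow> ('a, 'e) form2 \<Rightarrow> bool" where
  "two_form M \<omega> \<longleftrightarrow>
     (\<forall>(U, h) \<in> atlas M.
        (\<forall>x \<in> h ` U. bilinear (\<omega> (U, h) x) \<and> (\<forall>u. \<omega> (U, h) x u u = 0)) \<and>
        (\<forall>u v. smooth_on (h ` U) (\<lambda>x. \<omega> (U, h) x u v))) \<and>
     (\<forall>(U, h) \<in> atlas M. \<forall>(V, k) \<in> atlas M. \<forall>p \<in> U \<inter> V. \<forall>u v.
        \<omega> (U, h) (h p) u v =
        \<omega> (V, k) (k p) (frechet_derivative (k \<circ> inv_into U h) (at (h p)) u)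
                       (frechet_derivative (k \<circ> inv_into U h) (at (h p)) v))"

text \<open>On constant coordinate fields,
  \<open>d\<omega>(u, v, w) = D\<^sub>u \<omega>(v, w) - D\<^sub>v \<omega>(u, w) + D\<^sub>w \<omega>(u, v)\<close>.\<close>

definition closed_form :: "('a, 'e::euclidean_space) manifold \<Rightarrow> ('a, 'e) form2 \<Rightarrow> bool" where
  "closed_form M \<omega> \<longleftrightarrow>
     (\<forall>(U, h) \<in> atlas M. \<forall>x \<in> h ` U. \<forall>u v w.
        frechet_derivative (\<lambda>y. \<omega> (U, h) y v w) (at x) u
        - frechet_derivative (\<lambda>y. \<omega> (U, h) y u w) (at x) v
        + frechet_derivative (\<lambda>y. \<omega> (U, h) y u v) (at x) w = 0)"

definition nondegenerate_form :: "('a, 'e::euclidean_space) manifold \<Rightarrow> ('a, 'e) form2 \<Rightarrow> bool" where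
  "nondegenerate_form M \<omega> \<longleftrightarrow>
     (\<forall>(U, h) \<in> atlas M. \<forall>x \<in> h ` U. \<forall>u. (\<forall>v. \<omega> (U, h) x u v = 0) \<longrightarrow> u = 0)"

definition symplectic_manifold :: "('a, 'e::euclidean_space) manifold \<Rightarrow> ('a, 'e) form2 \<Rightarrow> bool" where
  "symplectic_manifold M \<omega> \<longleftrightarrow>
     smooth_manifold M \<and> two_form M \<omega> \<and> closed_form M \<omega> \<and> nondegenerate_form M \<omega>"

definition symplectomorphism ::
  "('a, 'e::euclidean_space) manifold \<Rightarrow> ('a, 'e) form2 \<Rightarrow>
   ('b, 'f::euclidean_space) manifold \<Rightarrow> ('b, 'f) form2 \<Rightarrow> ('a \<Rightarrow> 'b) \<Rightarrow> bool" where
  "symplectomorphism M \<omega> N \<eta> f \<longleftrightarrow>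
     diffeo_between M (topspace (mtop M)) N (topspace (mtop N)) f \<and>
     (\<forall>(U, h) \<in> atlas M. \<forall>(V, k) \<in> atlas N. \<forall>p \<in> U. f p \<in> V \<longrightarrow>
        (\<forall>u v. \<omega> (U, h) (h p) u v =
           \<eta> (V, k) (k (f p)) (frechet_derivative (k \<circ> f \<circ> inv_into U h) (at (h p)) u)
                              (frechet_derivative (k \<circ> f \<circ> inv_into U h) (at (h p)) v)))"

text \<open>In a 4-manifold a torus automatically has half the dimension of the ambient manifold.\<close>

definition lagrangian_torus ::
  "('a, real^4) manifold \<Rightarrow> ('a, real^4) form2 \<Rightarrow> 'a set \<Rightarrow> bool" where
  "lagrangian_torus M \<omega> T \<longleftrightarrow>
     embedded_torus M T \<and>
     (\<forall>(U, h) \<in> atlas M. \<forall>p \<in> T \<inter> U.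
        \<forall>u \<in> tangent_vectors M (U, h) T p. \<forall>v \<in> tangent_vectors M (U, h) T p.
          \<omega> (U, h) (h p) u v = 0)"


section \<open>Framings\<close>

text \<open>The tubular neighbourhood \<open>N\<close> is closed: it is the image of \<open>T \<times> cball 0 1\<close>, so that its
  boundary is its frontier in \<open>M\<close>. The disc \<open>D\<^sup>2\<close> is \<open>cball 0 1\<close> in the complex plane.\<close>

definition framing ::
  "('a, real^4) manifold \<Rightarrow> 'a set \<Rightarrow> 'a set \<Rightarrow> ('a \<times> complex \<Rightarrow> 'a) \<Rightarrow> bool" where
  "framing M T N \<phi> \<longleftrightarrow>
     N \<subseteq> topspace (mtop M) \<and>
     diffeo_between (product_manifold M euclidean_manifold) (T \<times> cball 0 1) M N \<phi> \<and>
     (\<forall>p\<in>T. \<phi> (p, 0) = p)"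

definition fundamental_class :: "'a topology \<Rightarrow> 'a set \<Rightarrow> 'a chain set \<Rightarrow> bool" where
  "fundamental_class X T c \<longleftrightarrow>
     c \<in> carrier (homology_group 2 (subtopology X T)) \<and>
     generate (homology_group 2 (subtopology X T)) {c} = carrier (homology_group 2 (subtopology X T))"

definition nullhomologous :: "'a topology \<Rightarrow> 'a set \<Rightarrow> bool" where
  "nullhomologous X T \<longleftrightarrow>
     (\<forall>c. fundamental_class X T c \<longrightarrow>
        hom_induced 2 (subtopology X T) {} X {} id c = \<one>\<^bsub>homology_group 2 X\<^esub>)"

text \<open>Since \<open>N\<close> is closed, the complement of the neighbourhood is taken to be that of the interior
  of \<open>N\<close>; it contains the boundary of \<open>N\<close>.\<close>

definition nullhomologous_framing ::
  "('a, real^4) manifold \<Rightarrow> 'a set \<Rightarrow> 'a set \<Rightarrow> ('a \<times> complex \<Rightarrow> 'a) \<Rightarrow> bool" where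
  "nullhomologous_framing M T N \<phi> \<longleftrightarrow>
     framing M T N \<phi> \<and>
     (let X = mtop M;
          bd = subtopology X (X frontier_of N);
          compl = subtopology X (topspace X - X interior_of N)
      in \<forall>x \<in> sphere 0 1. \<forall>c. fundamental_class X T c \<longrightarrow>
           hom_induced 2 (subtopology X T) {} bd {} (\<lambda>p. \<phi> (p, x)) c
             \<in> kernel (homology_group 2 bd) (homology_group 2 compl)
                 (hom_induced 2 bd {} compl {} id))"

definition lagrangian_framing ::
  "('a, real^4) manifold \<Rightarrow> ('a, real^4) form2 \<Rightarrow> 'a set \<Rightarrow> 'a set \<Rightarrow> ('a \<times> complex \<Rightarrow> 'a) \<Rightarrow> bool" where
  "lagrangian_framing M \<omega> T N \<phi> \<longleftrightarrow>
     framing M T N \<phi> \<and> (\<forall>x \<in> cball 0 1. lagrangian_torus M \<omega> (\<phi> ` (T \<times> {x})))"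

abbreviation circle :: "complex topology" where
  "circle \<equiv> top_of_set (sphere 0 1)"

definition difference_map ::
  "'a set \<Rightarrow> ('a \<times> complex \<Rightarrow> 'a) \<Rightarrow> ('a \<times> complex \<Rightarrow> 'a) \<Rightarrow> 'a \<Rightarrow> complex" where
  "difference_map T \<phi>\<^sub>0 \<phi>\<^sub>1 p = snd (inv_into (T \<times> cball 0 1) \<phi>\<^sub>0 (\<phi>\<^sub>1 (p, 1)))"

text \<open>The difference class as an element of \<open>[T, S\<^sup>1]\<close>, i.e. as a set of homotopic maps.\<close>

definition difference_class ::
  "'a topology \<Rightarrow> 'a set \<Rightarrow> ('a \<times> complex \<Rightarrow> 'a) \<Rightarrow> ('a \<times> complex \<Rightarrow> 'a) \<Rightarrow> ('a \<Rightarrow> complex) set" where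
  "difference_class X T \<phi>\<^sub>0 \<phi>\<^sub>1 =
     {g. homotopic_with (\<lambda>_. True) (subtopology X T) circle (difference_map T \<phi>\<^sub>0 \<phi>\<^sub>1) g}"


section \<open>The Lagrangian framing invariant\<close>

text \<open>\<open>framing_value M \<omega> T n\<close> states that the image of the difference homomorphism, for some choice
  of nullhomologous and Lagrangian framings of a common tubular neighbourhood, is \<open>n\<close> times the
  integers. The image does not depend on the representative of the difference class, nor on the
  isomorphism of the first homology of the circle with the integers.\<close>

definition framing_value ::
  "('a, real^4) manifold \<Rightarrow> ('a, real^4) form2 \<Rightarrow> 'a set \<Rightarrow> nat \<Rightarrow> bool" where
  "framing_value M \<omega> T n \<longleftrightarrow>
     (\<exists>N \<phi>\<^sub>N \<phi>\<^sub>L. nullhomologous_framing M T N \<phi>\<^sub>N \<and> lagrangian_framing M \<omega> T N \<phi>\<^sub>L \<and>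
        (\<exists>g \<in> difference_class (mtop M) T \<phi>\<^sub>N \<phi>\<^sub>L.
         \<exists>\<kappa> \<in> iso (homology_group 1 circle) integer_group.
           \<kappa> ` hom_induced 1 (subtopology (mtop M) T) {} circle {} g `
             carrier (homology_group 1 (subtopology (mtop M) T))
           = {int n * k | k. True}))"

definition lagrangian_framing_invariant ::
  "('a, real^4) manifold \<Rightarrow> ('a, real^4) form2 \<Rightarrow> 'a set \<Rightarrow> nat" where
  "lagrangian_framing_invariant M \<omega> T = (THE n. framing_value M \<omega> T n)"

end

theory Submission
  imports Defs
begin

text \<open>All data entering \<open>framing_value\<close> are carried along the symplectomorphism \<open>f\<close> with inverse
  \<open>g\<close>: a framing \<open>\<phi>\<close> of \<open>T\<close> becomes the framing \<open>(q, z) \<mapsto> f (\<phi> (g q, z))\<close> of \<open>f(T)\<close>. It is nullhomologous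
  if \<open>\<phi>\<close> is, by naturality of homology, and Lagrangian if \<open>\<phi>\<close> is, because \<open>g\<close> pulls \<open>\<omega>\<close> back to
  \<open>\<eta>\<close>. The difference map of two transported framings is the old one composed with \<open>g\<close>, so the
  image of its action on \<open>H\<^sub>1\<close> is unchanged. The same argument applied to \<open>g\<close> gives the converse.\<close>

section \<open>Calculus of smooth maps\<close>

text \<open>The work lies in the encodings. Smoothness on a subset means local extendability, tested
  in every pair of charts, so even carrying one framing to another requires that such maps compose;
  this comes down to the chain rule of every order. Tangent vectors and forms are compared through
  Frechet derivatives of coordinate expressions, and passing from \<open>f\<close> to
  \<open>g\<close> in the pullback condition requires that the coordinate derivative of
  \<open>f\<close> after that of \<open>g\<close> is the identity. The map \<open>g\<close> acts on
  the torus factor alone and the disc coordinate is kept, so the difference maps correspond exactly,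
  before passing to homotopy classes. Since the invariant is a definite description, the target is
  that \<open>framing_value\<close> holds for the same \<open>n\<close> on both sides; the
  descriptions then coincide.\<close>

lemma Ck_on_SucD:
  assumes "Ck_on (Suc k) S f"
  shows "\<And>x. x \<in> S \<Longrightarrow> (f has_derivative frechet_derivative f (at x)) (at x)"
    and "\<And>v. Ck_on k S (\<lambda>x. frechet_derivative f (at x) v)"
  using assms frechet_derivative_works by auto

text \<open>Derivatives at points of an open set depend only on the values on that set, so agreement
  on \<open>S\<close> passes to all iterated derivatives.\<close>

lemma Ck_on_cong:
  assumes "open S" "\<And>x. x \<in> S \<Longrightarrow> f x = g x" "Ck_on k S f"
  shows "Ck_on k S g"
  using assms
proof (induction k arbitrary: f g)
  case 0
  then show ?case
    by (auto cong: continuous_on_cong)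
next
  case (Suc k)
  have ev: "\<forall>\<^sub>F y in nhds x. f y = g y" if "x \<in> S" for x
    using Suc.prems that by (auto simp: eventually_nhds)
  have fd: "(g has_derivative frechet_derivative f (at x)) (at x)" if "x \<in> S" for x
  proof -
    have "(f has_derivative frechet_derivative f (at x)) (at x)"
      using Suc.prems that frechet_derivative_works by auto
    then show ?thesis
      by (rule has_derivative_transform_within_open[OF _ \<open>open S\<close> that]) (use Suc.prems in auto)
  qed
  then have eq: "frechet_derivative f (at x) = frechet_derivative g (at x)" if "x \<in> S" for x
    using that by (metis frechet_derivative_at)
  have "Ck_on k S (\<lambda>x. frechet_derivative g (at x) v)" for v
    by (rule Suc.IH[OF \<open>open S\<close> _ Ck_on_SucD(2)[OF Suc.prems(3)]]) (simp add: eq)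
  then show ?case
    using fd by (auto simp: differentiable_def)
qed

text \<open>Uniqueness of the derivative lets an explicit formula \<open>f'\<close> replace the
  choice term \<open>frechet_derivative\<close>. The algebraic closure rules and the chain rule
  exhibit such a formula.\<close>

lemma Ck_on_SucI:
  assumes "open S" "\<And>x. x \<in> S \<Longrightarrow> (f has_derivative f' x) (at x)"
    and "\<And>v. Ck_on k S (\<lambda>x. f' x v)"
  shows "Ck_on (Suc k) S f"
proof -
  have "f' x = frechet_derivative f (at x)" if "x \<in> S" for x
    using assms(2)[OF that] by (rule frechet_derivative_at)
  then have "Ck_on k S (\<lambda>x. frechet_derivative f (at x) v)" for v
    using assms by (intro Ck_on_cong[OF \<open>open S\<close> _ assms(3)[of v]]) auto
  then show ?thesis
    using assms(2) by (auto simp: differentiable_def)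
qed

lemma Ck_on_Suc_imp: "Ck_on (Suc k) S f \<Longrightarrow> Ck_on k S f"
proof (induction k arbitrary: f)
  case 0
  then show ?case
    by (auto intro!: continuous_at_imp_continuous_on differentiable_imp_continuous_within)
next
  case (Suc k)
  have "Ck_on k S (\<lambda>x. frechet_derivative f (at x) v)" for v
    by (intro Suc.IH Ck_on_SucD(2)[OF Suc.prems])
  then show ?case
    using Suc.prems by simp
qed

lemma Ck_on_const: "open S \<Longrightarrow> Ck_on k S (\<lambda>x. c)"
proof (induction k arbitrary: c)
  case (Suc k)
  then show ?case
    by (intro Ck_on_SucI[where f' = "\<lambda>x v. 0"]) auto
qed auto

lemma Ck_on_add:
  assumes "open S" "Ck_on k S f" "Ck_on k S g"
  shows "Ck_on k S (\<lambda>x. f x + g x)"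
  using assms
proof (induction k arbitrary: f g)
  case 0
  then show ?case
    by (auto intro!: continuous_intros)
next
  case (Suc k)
  show ?case
    by (rule Ck_on_SucI[OF \<open>open S\<close> has_derivative_add[OF Ck_on_SucD(1)[OF Suc.prems(2)]
            Ck_on_SucD(1)[OF Suc.prems(3)]]], assumption+,
        intro Suc.IH \<open>open S\<close> Ck_on_SucD(2)[OF Suc.prems(2)] Ck_on_SucD(2)[OF Suc.prems(3)])
qed

lemma Ck_on_sum:
  assumes "open S" "\<And>i. i \<in> I \<Longrightarrow> Ck_on k S (f i)"
  shows "Ck_on k S (\<lambda>x. \<Sum>i\<in>I. f i x)"
  using assms(2)
  by (induction I rule: infinite_finite_induct)
    (auto intro: Ck_on_const[OF \<open>open S\<close>] Ck_on_add[OF \<open>open S\<close>])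

text \<open>Leibniz rule: the derivative is a sum of two terms of the same bilinear shape, each with
  one undifferentiated factor that is used only to order \<open>k\<close>. The induction therefore
  runs over all pairs \<open>f\<close>, \<open>g\<close> at once.\<close>

lemma Ck_on_bounded_bilinear:
  assumes "bounded_bilinear B" "open S" "Ck_on k S f" "Ck_on k S g"
  shows "Ck_on k S (\<lambda>x. B (f x) (g x))"
  using assms(3,4)
proof (induction k arbitrary: f g)
  case 0
  then show ?case
    by (auto intro!: bounded_bilinear.continuous_on[OF assms(1)])
next
  case (Suc k)
  show ?case
    by (rule Ck_on_SucI[OF \<open>open S\<close> bounded_bilinear.FDERIV[OF assms(1)
            Ck_on_SucD(1)[OF Suc.prems(1)] Ck_on_SucD(1)[OF Suc.prems(2)]]], assumption+,
        intro Ck_on_add Suc.IH \<open>open S\<close> Ck_on_SucD(2)[OF Suc.prems(1)]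
          Ck_on_SucD(2)[OF Suc.prems(2)] Ck_on_Suc_imp[OF Suc.prems(1)]
          Ck_on_Suc_imp[OF Suc.prems(2)])
qed

lemma Ck_on_bounded_linear:
  assumes "bounded_linear L" "open S" "Ck_on k S f"
  shows "Ck_on k S (\<lambda>x. L (f x))"
  using assms(3)
proof (induction k arbitrary: f)
  case 0
  then show ?case
    by (auto intro!: bounded_linear.continuous_on[OF assms(1)])
next
  case (Suc k)
  show ?case
    by (rule Ck_on_SucI[OF \<open>open S\<close> bounded_linear.has_derivative[OF assms(1)]],
        rule Ck_on_SucD[OF Suc.prems(1)], assumption, intro Suc.IH Ck_on_SucD[OF Suc.prems(1)])
qed

lemma Ck_on_linear_self:
  assumes "bounded_linear L" "open S"
  shows "Ck_on k S L"
proof (cases k)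
  case 0
  then show ?thesis
    using assms(1) by (simp add: linear_continuous_on)
next
  case (Suc m)
  show ?thesis
    unfolding Suc
    by (rule Ck_on_SucI[OF \<open>open S\<close> bounded_linear_imp_has_derivative[OF assms(1)]])
      (rule Ck_on_const[OF \<open>open S\<close>])
qed

text \<open>Expanding the inner derivative in an orthonormal basis reduces the chain rule of order
  \<open>k + 1\<close> to sums, products and the chain rule of order \<open>k\<close>.\<close>

lemma Ck_on_compose:
  assumes "open S" "open R" "f ` S \<subseteq> R" "Ck_on k S f" "Ck_on k R g"
  shows "Ck_on k S (\<lambda>x. g (f x))"
  using assms(4,5)
proof (induction k arbitrary: g)
  case 0
  then show ?case
    using assms(3) by (auto intro: continuous_on_compose2)
next
  case (Suc k)
  let ?f' = "\<lambda>x. frechet_derivative f (at x)"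
  let ?g' = "\<lambda>x. frechet_derivative g (at x)"
  let ?D = "\<lambda>x v. \<Sum>b\<in>Basis. (?f' x v \<bullet> b) *\<^sub>R ?g' (f x) b"
  show ?case
  proof (rule Ck_on_SucI[OF \<open>open S\<close>, where f' = ?D])
    fix x assume x: "x \<in> S"
    then have g: "(g has_derivative ?g' (f x)) (at (f x))"
      using Ck_on_SucD(1)[OF Suc.prems(2)] assms(3) by blast
    have lin: "linear (?g' (f x))"
      using g has_derivative_linear by blast
    have "?g' (f x) (?f' x v) = ?D x v" for v
    proof -
      have "?g' (f x) (?f' x v) = ?g' (f x) (\<Sum>b\<in>Basis. (?f' x v \<bullet> b) *\<^sub>R b)"
        by (simp add: euclidean_representation)
      also have "\<dots> = ?D x v"
        by (simp add: linear_sum[OF lin] linear_cmul[OF lin])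
      finally show ?thesis .
    qed
    then show "((\<lambda>x. g (f x)) has_derivative ?D x) (at x)"
      using has_derivative_compose[OF Ck_on_SucD(1)[OF Suc.prems(1) x] g] by simp
  next
    fix v
    show "Ck_on k S (\<lambda>x. ?D x v)"
    proof (rule Ck_on_sum[OF \<open>open S\<close>], rule Ck_on_bounded_bilinear[OF bounded_bilinear_scaleR \<open>open S\<close>])
      fix b :: 'b
      show "Ck_on k S (\<lambda>x. ?f' x v \<bullet> b)"
        by (rule Ck_on_bounded_linear[OF bounded_linear_inner_left \<open>open S\<close> Ck_on_SucD(2)[OF Suc.prems(1)]])
      show "Ck_on k S (\<lambda>x. ?g' (f x) b)"
        by (rule Suc.IH[OF Ck_on_Suc_imp[OF Suc.prems(1)] Ck_on_SucD(2)[OF Suc.prems(2)]])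
    qed
  qed
qed

text \<open>The derivative at \<open>x\<close> is determined by the germ at \<open>x\<close>, so a
  neighbourhood \<open>R\<close> witnessing order \<open>k + 1\<close> for \<open>f\<close>
  witnesses order \<open>k\<close> for each directional derivative.\<close>

lemma Ck_on_local:
  assumes "\<And>x. x \<in> S \<Longrightarrow> \<exists>R. open R \<and> x \<in> R \<and> Ck_on k R f"
  shows "Ck_on k S f"
  using assms
proof (induction k arbitrary: f)
  case 0
  show ?case
    unfolding Ck_on.simps
  proof (rule continuous_at_imp_continuous_on, rule ballI)
    fix x assume "x \<in> S"
    with 0 obtain R where "open R" "x \<in> R" "Ck_on 0 R f" by blast
    then show "isCont f x"
      by (simp add: continuous_on_eq_continuous_at)
  qed
next
  case (Suc k)
  have "f differentiable (at x)" if "x \<in> S" for x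
    using Suc.prems[OF that] by auto
  moreover have "Ck_on k S (\<lambda>x. frechet_derivative f (at x) v)" for v
  proof (rule Suc.IH)
    fix x assume "x \<in> S"
    then obtain R where "open R" "x \<in> R" "Ck_on (Suc k) R f"
      using Suc.prems by blast
    then show "\<exists>R. open R \<and> x \<in> R \<and> Ck_on k R (\<lambda>x. frechet_derivative f (at x) v)"
      by (intro exI[of _ R] conjI Ck_on_SucD(2))
  qed
  ultimately show ?case by simp
qed

section \<open>Smoothness of all orders on open sets: locality, composition and products\<close>

lemma smooth_on_open: "smooth_on S f \<Longrightarrow> open S"
  by (simp add: smooth_on_def)

lemma smooth_on_Ck: "smooth_on S f \<Longrightarrow> Ck_on k S f"
  by (simp add: smooth_on_def)

lemma smooth_onI: "open S \<Longrightarrow> (\<And>k. Ck_on k S f) \<Longrightarrow> smooth_on S f"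
  by (simp add: smooth_on_def)

lemma smooth_on_cong:
  assumes "smooth_on S f" "\<And>x. x \<in> S \<Longrightarrow> f x = g x"
  shows "smooth_on S g"
  by (intro smooth_onI smooth_on_open[OF assms(1)])
    (rule Ck_on_cong[OF smooth_on_open[OF assms(1)] assms(2) smooth_on_Ck[OF assms(1)]])

text \<open>Openness of \<open>S\<close> is a conclusion, because the sets \<open>R\<close> exhaust
  \<open>S\<close>. This suits compositions, where a different middle chart may serve each point of
  the coordinate domain.\<close>

lemma smooth_on_local:
  assumes "\<And>x. x \<in> S \<Longrightarrow> \<exists>R f. x \<in> R \<and> R \<subseteq> S \<and> smooth_on R f \<and> (\<forall>y\<in>R. f y = g y)"
  shows "smooth_on S g"
proof -
  have *: "\<exists>R. open R \<and> x \<in> R \<and> R \<subseteq> S \<and> smooth_on R g" if "x \<in> S" for x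
  proof -
    from assms[OF that] obtain R f where R: "x \<in> R" "R \<subseteq> S" "smooth_on R f" "\<forall>y\<in>R. f y = g y"
      by blast
    have "smooth_on R g"
      by (rule smooth_on_cong[OF R(3)]) (use R(4) in simp)
    then show ?thesis
      using R(1,2) smooth_on_open[OF R(3)] by blast
  qed
  then have "open S"
    by (subst open_subopen) meson
  moreover have "Ck_on k S g" for k
  proof (rule Ck_on_local)
    fix x assume "x \<in> S"
    with * obtain R where "open R" "x \<in> R" "smooth_on R g"
      by blast
    then show "\<exists>R. open R \<and> x \<in> R \<and> Ck_on k R g"
      by (intro exI[of _ R] conjI smooth_on_Ck)
  qed
  ultimately show ?thesis
    by (rule smooth_onI)
qed

lemma Ck_on_subset: "S \<subseteq> R \<Longrightarrow> Ck_on k R f \<Longrightarrow> Ck_on k S f"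
proof (induction k arbitrary: f)
  case 0
  then show ?case
    by (auto intro: continuous_on_subset)
next
  case (Suc k)
  then show ?case
    by (simp add: subset_iff)
qed

lemma smooth_on_subset: "open S \<Longrightarrow> S \<subseteq> R \<Longrightarrow> smooth_on R f \<Longrightarrow> smooth_on S f"
  by (rule smooth_onI, assumption, erule Ck_on_subset, erule smooth_on_Ck)

lemma smooth_on_compose:
  assumes "smooth_on S f" "smooth_on R g" "f ` S \<subseteq> R"
  shows "smooth_on S (\<lambda>x. g (f x))"
  by (rule smooth_onI[OF smooth_on_open[OF assms(1)]],
      rule Ck_on_compose[OF smooth_on_open[OF assms(1)] smooth_on_open[OF assms(2)] assms(3)
        smooth_on_Ck[OF assms(1)] smooth_on_Ck[OF assms(2)]])

lemma smooth_on_bounded_linear: "bounded_linear L \<Longrightarrow> open S \<Longrightarrow> smooth_on S L"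
  by (simp add: smooth_on_def Ck_on_linear_self)

lemma smooth_on_Pair:
  assumes "smooth_on S f" "smooth_on S g"
  shows "smooth_on S (\<lambda>x. (f x, g x))"
proof -
  have 1: "bounded_linear (\<lambda>x::'b. (x, 0::'c))" and 2: "bounded_linear (\<lambda>x::'c. (0::'b, x))"
    by (auto intro!: bounded_linear_intros)
  have "Ck_on k S (\<lambda>x. (f x, 0) + (0, g x))" for k
    by (intro Ck_on_add Ck_on_bounded_linear[OF 1] Ck_on_bounded_linear[OF 2] assms
        smooth_on_open[OF assms(1)] smooth_on_Ck)
  then show ?thesis
    using assms by (simp add: smooth_on_def)
qed

lemma smooth_on_map_prod_id:
  assumes "smooth_on S f" "open R"
  shows "smooth_on (S \<times> R) (map_prod f id)"
proof -
  have op: "open (S \<times> R)"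
    using assms by (auto simp: smooth_on_def intro: open_Times)
  have "smooth_on (S \<times> R) (\<lambda>z. (f (fst z), snd z))"
    by (intro smooth_on_Pair smooth_on_compose[OF _ assms(1)] smooth_on_bounded_linear op
        bounded_linear_fst bounded_linear_snd) auto
  then show ?thesis
    by (rule smooth_on_cong) auto
qed

lemma smooth_on_differentiable: "smooth_on S f \<Longrightarrow> x \<in> S \<Longrightarrow> f differentiable (at x)"
  using smooth_on_Ck[of S f "Suc 0"] by simp

section \<open>Smooth maps of manifolds\<close>

text \<open>Collects the clauses on single charts: they govern the handling of coordinate
  expressions and pass to product manifolds by taking products of homeomorphisms.\<close>

definition charted :: "('a, 'e::euclidean_space) manifold \<Rightarrow> bool" where
  "charted M \<longleftrightarrow>
     (\<forall>(U, h) \<in> atlas M. openin (mtop M) U \<and> open (h ` U) \<and>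
        homeomorphic_map (subtopology (mtop M) U) (top_of_set (h ` U)) h) \<and>
     (\<Union>(U, h) \<in> atlas M. U) = topspace (mtop M)"

lemma smooth_manifold_charted: "smooth_manifold M \<Longrightarrow> charted M"
  by (simp add: smooth_manifold_def charted_def)

lemma chartedD:
  assumes "charted M" "(U, h) \<in> atlas M"
  shows "openin (mtop M) U" "open (h ` U)"
    "homeomorphic_map (subtopology (mtop M) U) (top_of_set (h ` U)) h"
    "inj_on h U" "U \<subseteq> topspace (mtop M)"
    "continuous_map (subtopology (mtop M) U) euclidean h"
proof -
  show *: "openin (mtop M) U" "open (h ` U)"
    "homeomorphic_map (subtopology (mtop M) U) (top_of_set (h ` U)) h"
    using assms by (auto simp: charted_def)
  show U: "U \<subseteq> topspace (mtop M)"
    using *(1) openin_subset by blast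
  then show "inj_on h U"
    using homeomorphic_imp_injective_map[OF *(3)] by (simp add: inf_absorb2)
  show "continuous_map (subtopology (mtop M) U) euclidean h"
    using homeomorphic_imp_continuous_map[OF *(3)] by (rule continuous_map_into_fulltopology)
qed

lemma charted_cover:
  assumes "charted M" "p \<in> topspace (mtop M)"
  obtains U h where "(U, h) \<in> atlas M" "p \<in> U"
  using assms unfolding charted_def by fastforce

lemma chart_image_open:
  assumes "charted M" "(U, h) \<in> atlas M" "openin (mtop M) W" "W \<subseteq> U"
  shows "open (h ` W)"
proof -
  have "openin (subtopology (mtop M) U) W"
    using assms(3,4) by (simp add: openin_subset_topspace_eq openin_open_subtopology
      chartedD(1)[OF assms(1,2)])
  then have "openin (top_of_set (h ` U)) (h ` W)"
    using homeomorphic_imp_open_map[OF chartedD(3)[OF assms(1,2)]] by (auto simp: open_map_def)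
  then show ?thesis
    using chartedD(2)[OF assms(1,2)] openin_open_trans by blast
qed

lemma inv_chart:
  assumes "charted M" "(U, h) \<in> atlas M" "p \<in> U"
  shows "inv_into U h (h p) = p"
  using chartedD(4)[OF assms(1,2)] assms(3) by simp

lemma smooth_map_openI:
  assumes "openin (mtop M) W" "continuous_map (subtopology (mtop M) W) (mtop N) F"
    "\<And>U h V k. (U, h) \<in> atlas M \<Longrightarrow> (V, k) \<in> atlas N \<Longrightarrow>
        smooth_on (h ` {p \<in> W \<inter> U. F p \<in> V}) (k \<circ> F \<circ> inv_into U h)"
  shows "smooth_map_open M N W F"
  using assms unfolding smooth_map_open_def by blast

lemma smooth_map_openD:
  assumes "smooth_map_open M N W F"
  shows "openin (mtop M) W" "continuous_map (subtopology (mtop M) W) (mtop N) F"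
    "(U, h) \<in> atlas M \<Longrightarrow> (V, k) \<in> atlas N \<Longrightarrow>
        smooth_on (h ` {p \<in> W \<inter> U. F p \<in> V}) (k \<circ> F \<circ> inv_into U h)"
  using assms by (auto simp: smooth_map_open_def)

lemma smooth_map_open_vimage:
  assumes "smooth_map_open M N W F" "openin (mtop N) V"
  shows "openin (mtop M) {p \<in> W. F p \<in> V}"
proof -
  have "W \<subseteq> topspace (mtop M)"
    using smooth_map_openD(1)[OF assms(1)] openin_subset by blast
  then have "openin (subtopology (mtop M) W) {p \<in> W. F p \<in> V}"
    using openin_continuous_map_preimage[OF smooth_map_openD(2)[OF assms(1)] assms(2)]
    by (simp add: inf_absorb2)
  then show ?thesis
    using openin_trans_full smooth_map_openD(1)[OF assms(1)] by blast
qed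

text \<open>Around each point, a chart of \<open>N\<close> at \<open>F p\<close> splits the
  coordinate expression of \<open>G \<circ> F\<close> into those of \<open>F\<close> and
  \<open>G\<close>. Euclidean composition applies there, and \<open>smooth_on_local\<close> glues
  the pieces.\<close>

lemma smooth_map_open_compose:
  assumes M: "charted M" and N: "charted N"
    and F: "smooth_map_open M N W F" and G: "smooth_map_open N P W' G"
  shows "smooth_map_open M P {p \<in> W. F p \<in> W'} (G \<circ> F)"
proof (rule smooth_map_openI, goal_cases)
  case 1
  show ?case
    by (rule smooth_map_open_vimage[OF F smooth_map_openD(1)[OF G]])
next
  case 2
  have "continuous_map (subtopology (mtop M) {p \<in> W. F p \<in> W'}) (subtopology (mtop N) W') F"
    unfolding continuous_map_in_subtopology
    by (auto intro: continuous_map_from_subtopology_mono[OF smooth_map_openD(2)[OF F]])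
  then show ?case
    by (rule continuous_map_compose[OF _ smooth_map_openD(2)[OF G]])
next
  case U: (3 U h V k)
  note V = U(2) and U = U(1)
  let ?S = "h ` {p \<in> {p \<in> W. F p \<in> W'} \<inter> U. (G \<circ> F) p \<in> V}"
  show ?case
  proof (rule smooth_on_local)
    fix x assume "x \<in> ?S"
    then obtain p where p: "p \<in> W" "F p \<in> W'" "p \<in> U" "G (F p) \<in> V" "x = h p"
      by auto
    have "F p \<in> topspace (mtop N)"
      using p(2) openin_subset[OF smooth_map_openD(1)[OF G]] by blast
    then obtain U' l where U': "(U', l) \<in> atlas N" "F p \<in> U'"
      by (rule charted_cover[OF N])
    let ?A = "h ` {q \<in> W \<inter> U. F q \<in> U'}" and ?f = "l \<circ> F \<circ> inv_into U h"
    let ?B = "l ` {q \<in> W' \<inter> U'. G q \<in> V}" and ?g = "k \<circ> G \<circ> inv_into U' l"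
    have f: "smooth_on ?A ?f" and g: "smooth_on ?B ?g"
      using smooth_map_openD(3)[OF F U U'(1)] smooth_map_openD(3)[OF G U'(1) V] .
    \<comment> \<open>The region on which the middle chart factors the composite. It is open because
      \<open>?f\<close> is continuous on the open set \<open>?A\<close> and \<open>?B\<close> is
      open.\<close>
    let ?R = "?A \<inter> ?f -` ?B"
    have "open ?R"
      using smooth_on_Ck[OF f, of 0] smooth_on_open[OF f] smooth_on_open[OF g]
      by (auto intro: continuous_open_preimage)
    then have "smooth_on ?R (\<lambda>x. ?g (?f x))"
      by (intro smooth_on_compose[OF smooth_on_subset[OF _ _ f] g]) auto
    \<comment> \<open>\<open>?B\<close> constrains \<open>F q\<close> only through its coordinates;
      injectivity of \<open>l\<close> on \<open>U'\<close> turns this into conditions on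
      \<open>F q\<close> itself.\<close>
    moreover have R: "\<exists>q. y = h q \<and> q \<in> W \<and> q \<in> U \<and> F q \<in> U' \<and> F q \<in> W' \<and> G (F q) \<in> V"
      if "y \<in> ?R" for y
    proof -
      from that obtain q where q: "q \<in> W" "q \<in> U" "F q \<in> U'" "y = h q" and "?f y \<in> ?B"
        by auto
      then have "l (F q) \<in> ?B"
        by (simp add: inv_chart[OF M U])
      then obtain r where "r \<in> W'" "r \<in> U'" "G r \<in> V" "l (F q) = l r"
        by auto
      with q show ?thesis
        by (metis inv_chart[OF N U'(1)])
    qed
    moreover have "x \<in> ?R"
      using p U' inv_chart[OF M U] by auto
    moreover have "?g (?f y) = (k \<circ> (G \<circ> F) \<circ> inv_into U h) y" if "y \<in> ?R" for y
      using R[OF that] by (auto simp: inv_chart[OF M U] inv_chart[OF N U'(1)])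
    moreover have "?R \<subseteq> ?S"
    proof
      fix y assume "y \<in> ?R"
      then obtain q where "y = h q" "q \<in> W" "q \<in> U" "F q \<in> W'" "G (F q) \<in> V"
        using R by meson
      then show "y \<in> ?S"
        by auto
    qed
    ultimately show "\<exists>R f. x \<in> R \<and> R \<subseteq> ?S \<and> smooth_on R f \<and>
        (\<forall>y\<in>R. f y = (k \<circ> (G \<circ> F) \<circ> inv_into U h) y)"
      by (intro exI[of _ ?R] exI[of _ "\<lambda>x. ?g (?f x)"] conjI ballI)
  qed
qed

section \<open>Smooth maps between arbitrary subsets of manifolds\<close>

lemma smooth_betweenD:
  assumes "smooth_between M S N R f" "p \<in> S"
  obtains W F where "p \<in> W" "smooth_map_open M N W F" "\<And>q. q \<in> S \<Longrightarrow> q \<in> W \<Longrightarrow> F q = f q"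
  using assms unfolding smooth_between_def by blast

lemma smooth_between_compose:
  assumes "charted M" "charted N" "smooth_between M S N R f" "smooth_between N R P Q g"
  shows "smooth_between M S P Q (g \<circ> f)"
  unfolding smooth_between_def
proof (intro conjI ballI)
  have fS: "f ` S \<subseteq> R" and "g ` R \<subseteq> Q"
    using assms(3,4) by (auto simp: smooth_between_def)
  then show "(g \<circ> f) ` S \<subseteq> Q"
    by auto
  fix p assume p: "p \<in> S"
  obtain W F where F: "p \<in> W" "smooth_map_open M N W F" "\<And>q. q \<in> S \<Longrightarrow> q \<in> W \<Longrightarrow> F q = f q"
    using smooth_betweenD[OF assms(3) p] by blast
  have "f p \<in> R"
    using fS p by blast
  then obtain W' G where G: "f p \<in> W'" "smooth_map_open N P W' G"
    "\<And>q. q \<in> R \<Longrightarrow> q \<in> W' \<Longrightarrow> G q = g q"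
    using smooth_betweenD[OF assms(4)] by blast
  show "\<exists>W F. p \<in> W \<and> smooth_map_open M P W F \<and> (\<forall>q\<in>S \<inter> W. F q = (g \<circ> f) q)"
    using smooth_map_open_compose[OF assms(1,2) F(2) G(2)] F(1,3) G(1,3) p fS
    by (intro exI[of _ "{p \<in> W. F p \<in> W'}"] exI[of _ "G \<circ> F"]) auto
qed

lemma smooth_between_cong:
  assumes "smooth_between M S N R f" "\<And>p. p \<in> S \<Longrightarrow> f p = g p"
  shows "smooth_between M S N R g"
  using assms unfolding smooth_between_def by (simp add: image_subset_iff)

lemma smooth_between_mono:
  assumes "smooth_between M S N R f" "S' \<subseteq> S" "f ` S' \<subseteq> R'"
  shows "smooth_between M S' N R' f"
  using assms unfolding smooth_between_def by (meson IntD1 IntD2 IntI subsetD)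

text \<open>Continuity is local and each local extension is continuous. This is the passage from
  smooth maps to their action on homology.\<close>

lemma smooth_between_continuous_map:
  assumes "smooth_between M S N R f"
  shows "continuous_map (subtopology (mtop M) S) (mtop N) f"
proof -
  have "f p \<in> topspace (mtop N)" if p: "p \<in> S" "p \<in> topspace (mtop M)" for p
  proof -
    obtain W F where F: "p \<in> W" "smooth_map_open M N W F" "\<And>q. q \<in> S \<Longrightarrow> q \<in> W \<Longrightarrow> F q = f q"
      using smooth_betweenD[OF assms p(1)] by blast
    have "p \<in> topspace (subtopology (mtop M) W)"
      using p(2) F(1) by simp
    then have "F p \<in> topspace (mtop N)"
      using smooth_map_openD(2)[OF F(2)] by (auto simp: continuous_map_def)
    then show ?thesis
      using F(1,3) p(1) by simp
  qed
  moreover have "openin (subtopology (mtop M) S) {p \<in> topspace (subtopology (mtop M) S). f p \<in> V}"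
    (is "openin _ ?L") if V: "openin (mtop N) V" for V
  proof (subst openin_subopen, intro ballI)
    fix p assume "p \<in> ?L"
    then have p: "p \<in> S" "p \<in> topspace (mtop M)" "f p \<in> V"
      by auto
    obtain W F where F: "p \<in> W" "smooth_map_open M N W F" "\<And>q. q \<in> S \<Longrightarrow> q \<in> W \<Longrightarrow> F q = f q"
      using smooth_betweenD[OF assms p(1)] by blast
    have "openin (mtop M) {p \<in> W. F p \<in> V}" (is "openin _ ?D")
      by (rule smooth_map_open_vimage[OF F(2) V])
    then show "\<exists>T. openin (subtopology (mtop M) S) T \<and> p \<in> T \<and> T \<subseteq> ?L"
      using p F(1,3) openin_subset[of "mtop M" ?D]
      by (intro exI[of _ "?D \<inter> S"]) (auto simp: openin_subtopology)
  qed
  ultimately show ?thesis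
    by (auto simp: continuous_map_def)
qed

section \<open>Products with a Euclidean factor\<close>

lemma charted_euclidean: "charted euclidean_manifold"
  by (simp add: charted_def euclidean_manifold_def)

lemma charted_product:
  assumes M: "charted M" and N: "charted N"
  shows "charted (product_manifold M N)"
proof -
  have "openin (prod_topology (mtop M) (mtop N)) (U \<times> V)"
    "open (map_prod h k ` (U \<times> V))"
    "homeomorphic_map (subtopology (prod_topology (mtop M) (mtop N)) (U \<times> V))
       (top_of_set (map_prod h k ` (U \<times> V))) (map_prod h k)"
    if "(U, h) \<in> atlas M" "(V, k) \<in> atlas N" for U h V k
  proof -
    note U = chartedD[OF M that(1)] and V = chartedD[OF N that(2)]
    have im: "map_prod h k ` (U \<times> V) = h ` U \<times> k ` V"
      by auto
    show "openin (prod_topology (mtop M) (mtop N)) (U \<times> V)"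
      using U V by (simp add: openin_prod_Times_iff)
    show "open (map_prod h k ` (U \<times> V))"
      unfolding im using U V by (simp add: open_Times)
    obtain h' where h': "homeomorphic_maps (subtopology (mtop M) U) (top_of_set (h ` U)) h h'"
      using U(3) homeomorphic_map_maps by blast
    obtain k' where k': "homeomorphic_maps (subtopology (mtop N) V) (top_of_set (k ` V)) k k'"
      using V(3) homeomorphic_map_maps by blast
    have "homeomorphic_maps (prod_topology (subtopology (mtop M) U) (subtopology (mtop N) V))
      (prod_topology (top_of_set (h ` U)) (top_of_set (k ` V)))
      (\<lambda>(x,y). (h x, k y)) (\<lambda>(x,y). (h' x, k' y))"
      using h' k' homeomorphic_maps_prod by blast
    then show "homeomorphic_map (subtopology (prod_topology (mtop M) (mtop N)) (U \<times> V))
       (top_of_set (map_prod h k ` (U \<times> V))) (map_prod h k)"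
      unfolding im subtopology_Times homeomorphic_map_maps prod_topology_subtopology_eu
      unfolding map_prod_def by blast
  qed
  moreover have "(\<Union>c \<in> atlas (product_manifold M N). fst c) = topspace (mtop M) \<times> topspace (mtop N)"
  proof -
    have "topspace (mtop M) = (\<Union>c \<in> atlas M. fst c)" "topspace (mtop N) = (\<Union>c \<in> atlas N. fst c)"
      using M N by (auto simp: charted_def case_prod_unfold)
    then show ?thesis
      unfolding product_manifold_def by (auto simp: Bex_def) blast
  qed
  ultimately show ?thesis
    unfolding charted_def by (auto simp: product_manifold_def case_prod_unfold)
qed

text \<open>Every chart of a product with \<open>euclidean_manifold\<close> has the form
  \<open>map_prod h id\<close> on \<open>U \<times> UNIV\<close>, so the coordinate expression is
  that of \<open>F\<close> times the identity. The source of a framing is changed in this way: the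
  torus moves and the disc coordinate is fixed.\<close>

lemma smooth_map_open_map_prod_id:
  fixes M :: "('a, 'e::euclidean_space) manifold" and N :: "('b, 'f::euclidean_space) manifold"
  assumes M: "charted M" and F: "smooth_map_open M N W F"
  shows "smooth_map_open (product_manifold M euclidean_manifold) (product_manifold N euclidean_manifold)
     (W \<times> (UNIV :: 'c::euclidean_space set)) (map_prod F id)"
proof (rule smooth_map_openI, goal_cases)
  case 1
  show ?case
    using smooth_map_openD(1)[OF F]
    by (simp add: product_manifold_def euclidean_manifold_def openin_prod_Times_iff)
next
  case 2
  have "continuous_map (prod_topology (subtopology (mtop M) W) (euclidean :: 'c topology))
     (prod_topology (mtop N) euclidean) (\<lambda>(x, y). (F x, id y))"
    using smooth_map_openD(2)[OF F] unfolding continuous_map_prod_top by simp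
  then show ?case
    by (simp add: product_manifold_def euclidean_manifold_def map_prod_def
        prod_topology_subtopology(1))
next
  case (3 A a B b)
  then obtain U h V k where c: "A = U \<times> UNIV" "a = map_prod h id" "B = V \<times> UNIV" "b = map_prod k id"
    and U: "(U, h) \<in> atlas M" and V: "(V, k) \<in> atlas N"
    by (auto simp: product_manifold_def euclidean_manifold_def)
  let ?S = "h ` {p \<in> W \<inter> U. F p \<in> V}"
  have im: "map_prod h id ` {p \<in> W \<times> UNIV \<inter> U \<times> UNIV. map_prod F id p \<in> V \<times> UNIV} = ?S \<times> (UNIV :: 'c set)"
    by force
  have inj: "inj_on (map_prod h (id :: 'c \<Rightarrow> 'c)) (U \<times> UNIV)"
    using chartedD(4)[OF M U] by (auto simp: inj_on_def)
  have "smooth_on (?S \<times> (UNIV :: 'c set)) (map_prod (k \<circ> F \<circ> inv_into U h) id)"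
    by (rule smooth_on_map_prod_id[OF smooth_map_openD(3)[OF F U V] open_UNIV])
  then have "smooth_on (?S \<times> (UNIV :: 'c set))
      (map_prod k id \<circ> map_prod F id \<circ> inv_into (U \<times> UNIV) (map_prod h id))"
  proof (rule smooth_on_cong)
    fix x :: "'e \<times> 'c" assume "x \<in> ?S \<times> UNIV"
    then obtain p z where p: "p \<in> U" "x = map_prod h id (p, z)"
      by auto
    have "inv_into (U \<times> UNIV) (map_prod h id) x = (p, z)"
      unfolding p(2) by (rule inv_into_f_f[OF inj]) (use p in simp)
    then show "map_prod (k \<circ> F \<circ> inv_into U h) id x =
        (map_prod k id \<circ> map_prod F id \<circ> inv_into (U \<times> UNIV) (map_prod h id)) x"
      using p by (simp add: inv_chart[OF M U])
  qed
  then show ?case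
    unfolding c im .
qed

lemma smooth_between_map_prod_id:
  fixes M :: "('a, 'e::euclidean_space) manifold" and N :: "('b, 'f::euclidean_space) manifold"
    and D :: "'c::euclidean_space set"
  assumes M: "charted M" and f: "smooth_between M S N R f"
  shows "smooth_between (product_manifold M euclidean_manifold) (S \<times> D)
     (product_manifold N euclidean_manifold) (R \<times> D) (map_prod f id)"
  unfolding smooth_between_def
proof (intro conjI ballI)
  show "map_prod f id ` (S \<times> D) \<subseteq> R \<times> D"
    using f by (auto simp: smooth_between_def)
  fix z assume "z \<in> S \<times> D"
  then have z: "fst z \<in> S"
    by auto
  obtain W F where F: "fst z \<in> W" "smooth_map_open M N W F" "\<And>q. q \<in> S \<Longrightarrow> q \<in> W \<Longrightarrow> F q = f q"
    using smooth_betweenD[OF f z] by blast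
  show "\<exists>W F. z \<in> W \<and>
     smooth_map_open (product_manifold M euclidean_manifold) (product_manifold N euclidean_manifold) W F \<and>
     (\<forall>q\<in>S \<times> D \<inter> W. F q = map_prod f id q)"
    using smooth_map_open_map_prod_id[OF M F(2)] F(1,3)
    by (intro exI[of _ "W \<times> UNIV"] exI[of _ "map_prod F id"]) (auto simp: mem_Times_iff)
qed

text \<open>Any smooth two-sided inverse agrees on \<open>R\<close> with
  \<open>inv_into S f\<close>. Working with such a witness makes composition and the exchange of
  source and target immediate.\<close>

lemma diffeo_between_iff:
  "diffeo_between M S N R f \<longleftrightarrow>
     (\<exists>g. smooth_between M S N R f \<and> smooth_between N R M S g \<and>
        (\<forall>x\<in>S. g (f x) = x) \<and> (\<forall>y\<in>R. f (g y) = y))"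
proof
  assume "diffeo_between M S N R f"
  then show "\<exists>g. smooth_between M S N R f \<and> smooth_between N R M S g \<and>
        (\<forall>x\<in>S. g (f x) = x) \<and> (\<forall>y\<in>R. f (g y) = y)"
    by (intro exI[of _ "inv_into S f"])
      (auto simp: diffeo_between_def bij_betw_inv_into_left bij_betw_inv_into_right)
next
  assume "\<exists>g. smooth_between M S N R f \<and> smooth_between N R M S g \<and>
        (\<forall>x\<in>S. g (f x) = x) \<and> (\<forall>y\<in>R. f (g y) = y)"
  then obtain g where g: "smooth_between M S N R f" "smooth_between N R M S g"
    "\<forall>x\<in>S. g (f x) = x" "\<forall>y\<in>R. f (g y) = y"
    by blast
  have "f ` S \<subseteq> R" and gR: "g ` R \<subseteq> S"
    using g(1,2) by (auto simp: smooth_between_def)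
  with g(3,4) have bij: "bij_betw f S R"
    by (intro bij_betw_byWitness)
  have "g y = inv_into S f y" if "y \<in> R" for y
    using that g(4) gR bij by (intro inv_into_f_eq[symmetric]) (auto simp: bij_betw_def)
  then show "diffeo_between M S N R f"
    using g(1) bij smooth_between_cong[OF g(2)] by (simp add: diffeo_between_def)
qed

lemma diffeo_between_compose:
  assumes "charted M" "charted N" "charted P"
    and f: "diffeo_between M S N R f" and g: "diffeo_between N R P Q g"
  shows "diffeo_between M S P Q (g \<circ> f)"
proof -
  obtain f' where f': "smooth_between M S N R f" "smooth_between N R M S f'"
    "\<forall>x\<in>S. f' (f x) = x" "\<forall>y\<in>R. f (f' y) = y"
    using f unfolding diffeo_between_iff by blast
  obtain g' where g': "smooth_between N R P Q g" "smooth_between P Q N R g'"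
    "\<forall>x\<in>R. g' (g x) = x" "\<forall>y\<in>Q. g (g' y) = y"
    using g unfolding diffeo_between_iff by blast
  have im: "f ` S \<subseteq> R" "g' ` Q \<subseteq> R"
    using f'(1) g'(2) by (auto simp: smooth_between_def)
  show ?thesis
    unfolding diffeo_between_iff
    by (intro exI[of _ "f' \<circ> g'"] conjI smooth_between_compose[OF assms(1,2) f'(1) g'(1)]
        smooth_between_compose[OF assms(3,2) g'(2) f'(2)])
      (use im f' g' in auto)
qed

text \<open>The local extension \<open>F\<close> agrees with \<open>f\<close> only on
  \<open>S\<close>, whereas a derivative at \<open>h p\<close> sees a whole neighbourhood; openness
  of \<open>S\<close> makes the agreement hold near \<open>p\<close>.\<close>

lemma coordinate_map_differentiable:
  assumes M: "charted M" and N: "charted N" and f: "smooth_between M S N R f"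
    and S: "openin (mtop M) S" and U: "(U, h) \<in> atlas M" and V: "(V, k) \<in> atlas N"
    and p: "p \<in> S" "p \<in> U" "f p \<in> V"
  shows "(k \<circ> f \<circ> inv_into U h) differentiable (at (h p))"
proof -
  obtain W F where F: "p \<in> W" "smooth_map_open M N W F" "\<And>q. q \<in> S \<Longrightarrow> q \<in> W \<Longrightarrow> F q = f q"
    using smooth_betweenD[OF f p(1)] by blast
  have "F p = f p"
    using F(1,3) p(1) by blast
  have "(k \<circ> F \<circ> inv_into U h) differentiable (at (h p))"
    by (rule smooth_on_differentiable[OF smooth_map_openD(3)[OF F(2) U V]])
      (use F(1) p \<open>F p = f p\<close> in auto)
  then obtain D where D: "((k \<circ> F \<circ> inv_into U h) has_derivative D) (at (h p))"
    by (auto simp: differentiable_def)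
  let ?B = "{q \<in> W. F q \<in> V} \<inter> U \<inter> S"
  have B: "open (h ` ?B)"
    using smooth_map_open_vimage[OF F(2) chartedD(1)[OF N V]] chartedD(1)[OF M U] S
    by (intro chart_image_open[OF M U]) auto
  have "((k \<circ> f \<circ> inv_into U h) has_derivative D) (at (h p))"
  proof (rule has_derivative_transform_within_open[OF D B])
    show "h p \<in> h ` ?B"
      using F(1) p \<open>F p = f p\<close> by auto
    show "(k \<circ> F \<circ> inv_into U h) x = (k \<circ> f \<circ> inv_into U h) x" if "x \<in> h ` ?B" for x
      using that F(3) by (auto simp: inv_chart[OF M U])
  qed
  then show ?thesis
    by (auto simp: differentiable_def)
qed


section \<open>Transport along a symplectomorphism\<close>

text \<open>The pullback clause of \<open>symplectomorphism\<close>, isolated so that it can be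
  asserted of the inverse map as well.\<close>

definition preserves_form ::
  "('a, 'e::euclidean_space) manifold \<Rightarrow> ('a, 'e) form2 \<Rightarrow>
   ('b, 'f::euclidean_space) manifold \<Rightarrow> ('b, 'f) form2 \<Rightarrow> ('a \<Rightarrow> 'b) \<Rightarrow> bool" where
  "preserves_form M \<omega> N \<eta> f \<longleftrightarrow>
     (\<forall>(U, h) \<in> atlas M. \<forall>(V, k) \<in> atlas N. \<forall>p \<in> U. f p \<in> V \<longrightarrow>
        (\<forall>u v. \<omega> (U, h) (h p) u v =
           \<eta> (V, k) (k (f p)) (frechet_derivative (k \<circ> f \<circ> inv_into U h) (at (h p)) u)
                              (frechet_derivative (k \<circ> f \<circ> inv_into U h) (at (h p)) v)))"

lemma preserves_formD:
  assumes "preserves_form M \<omega> N \<eta> f" "(U, h) \<in> atlas M" "(V, k) \<in> atlas N" "p \<in> U" "f p \<in> V"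
  shows "\<omega> (U, h) (h p) u v =
           \<eta> (V, k) (k (f p)) (frechet_derivative (k \<circ> f \<circ> inv_into U h) (at (h p)) u)
                              (frechet_derivative (k \<circ> f \<circ> inv_into U h) (at (h p)) v)"
  using assms unfolding preserves_form_def by blast

text \<open>The inverse is a parameter instead of an \<open>inv_into\<close> term, which makes the
  situation symmetric: every transport result is available in both directions.\<close>

locale manifold_equivalence =
  fixes X :: "('a, 'e::euclidean_space) manifold" and Y :: "('b, 'f::euclidean_space) manifold"
    and f :: "'a \<Rightarrow> 'b" and g :: "'b \<Rightarrow> 'a"
  assumes X: "charted X" and Y: "charted Y"
    and f: "smooth_between X (topspace (mtop X)) Y (topspace (mtop Y)) f"
    and g: "smooth_between Y (topspace (mtop Y)) X (topspace (mtop X)) g"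
    and gf: "p \<in> topspace (mtop X) \<Longrightarrow> g (f p) = p"
    and fg: "q \<in> topspace (mtop Y) \<Longrightarrow> f (g q) = q"
begin

lemma homeo: "homeomorphic_maps (mtop X) (mtop Y) f g"
  using smooth_between_continuous_map[OF f] smooth_between_continuous_map[OF g] gf fg
  by (simp add: homeomorphic_maps_def)

lemma f_in: "p \<in> topspace (mtop X) \<Longrightarrow> f p \<in> topspace (mtop Y)"
  and g_in: "q \<in> topspace (mtop Y) \<Longrightarrow> g q \<in> topspace (mtop X)"
  using f g by (auto simp: smooth_between_def)

lemma diffeo_restrict:
  assumes "S \<subseteq> topspace (mtop X)"
  shows "diffeo_between X S Y (f ` S) f" "diffeo_between Y (f ` S) X S g"
proof -
  have "smooth_between X S Y (f ` S) f"
    by (rule smooth_between_mono[OF f assms order_refl])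
  moreover have "smooth_between Y (f ` S) X S g"
  proof (rule smooth_between_mono[OF g])
    show "f ` S \<subseteq> topspace (mtop Y)" "g ` f ` S \<subseteq> S"
      using assms gf f_in by auto
  qed
  moreover have "\<forall>x\<in>S. g (f x) = x" "\<forall>y\<in>f ` S. f (g y) = y"
    using assms gf by auto
  ultimately show "diffeo_between X S Y (f ` S) f" "diffeo_between Y (f ` S) X S g"
    unfolding diffeo_between_iff by auto
qed

lemma coordinate_derivative:
  assumes "(U, h) \<in> atlas X" "(V, k) \<in> atlas Y" "q \<in> V" "g q \<in> U"
  shows "((h \<circ> g \<circ> inv_into V k) has_derivative
           frechet_derivative (h \<circ> g \<circ> inv_into V k) (at (k q))) (at (k q))"
proof -
  have "q \<in> topspace (mtop Y)"
    using assms(3) chartedD(5)[OF Y assms(2)] by blast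
  then show ?thesis
    using coordinate_map_differentiable[OF Y X g openin_topspace assms(2,1)] assms(3,4)
    by (simp add: frechet_derivative_works)
qed

text \<open>Composing with \<open>g\<close> turns a curve in f(S) with velocity \<open>v\<close>
  into a curve in \<open>S\<close>, and the chain rule gives its velocity in the chart
  \<open>(U, h)\<close>.\<close>

lemma tangent_vectors_transport:
  assumes U: "(U, h) \<in> atlas X" and V: "(V, k) \<in> atlas Y" and q: "q \<in> V" "g q \<in> U"
    and S: "S \<subseteq> topspace (mtop X)" and v: "v \<in> tangent_vectors Y (V, k) (f ` S) q"
  shows "frechet_derivative (h \<circ> g \<circ> inv_into V k) (at (k q)) v \<in> tangent_vectors X (U, h) S (g q)"
proof -
  let ?D = "frechet_derivative (h \<circ> g \<circ> inv_into V k) (at (k q))"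
  obtain \<gamma> \<epsilon> where \<gamma>: "\<epsilon> > 0"
    "smooth_between (euclidean_manifold :: (real, _) manifold) {-\<epsilon><..<\<epsilon>} Y (f ` S) \<gamma>"
    "\<gamma> 0 = q" "((k \<circ> \<gamma>) has_vector_derivative v) (at 0)"
    using v by (auto simp: tangent_vectors_def)
  have "smooth_between Y (f ` S) X S g"
    using diffeo_restrict(2)[OF S] by (simp add: diffeo_between_def)
  then have sm: "smooth_between euclidean_manifold {-\<epsilon><..<\<epsilon>} X S (g \<circ> \<gamma>)"
    by (rule smooth_between_compose[OF charted_euclidean Y \<gamma>(2)])
  \<comment> \<open>The curve may leave \<open>V\<close>. Continuity supplies an open set of times
    around 0 during which it stays there, so that \<open>inv_into V k\<close> undoes
    \<open>k\<close>.\<close>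
  have "continuous_map (top_of_set {-\<epsilon><..<\<epsilon>}) (mtop Y) \<gamma>"
    using smooth_between_continuous_map[OF \<gamma>(2)] by (simp add: euclidean_manifold_def)
  from openin_continuous_map_preimage[OF this chartedD(1)[OF Y V]]
  have "openin (top_of_set {-\<epsilon><..<\<epsilon>}) {t \<in> {-\<epsilon><..<\<epsilon>}. \<gamma> t \<in> V}"
    by simp
  then have op: "open {t \<in> {-\<epsilon><..<\<epsilon>}. \<gamma> t \<in> V}"
    by (rule openin_open_trans[OF _ open_greaterThanLessThan])
  have D: "((h \<circ> g \<circ> inv_into V k) has_derivative ?D) (at ((k \<circ> \<gamma>) 0))"
    using coordinate_derivative[OF U V q] \<gamma>(3) by simp
  have "((\<lambda>t. (h \<circ> g \<circ> inv_into V k) ((k \<circ> \<gamma>) t)) has_derivative (\<lambda>s. ?D (s *\<^sub>R v))) (at 0)"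
    using has_derivative_compose[OF \<gamma>(4)[unfolded has_vector_derivative_def] D] by simp
  then have "((\<lambda>t. (h \<circ> g \<circ> inv_into V k) ((k \<circ> \<gamma>) t)) has_vector_derivative ?D v) (at 0)"
    by (simp add: has_vector_derivative_def linear_cmul[OF has_derivative_linear[OF D]])
  then have "((h \<circ> (g \<circ> \<gamma>)) has_vector_derivative ?D v) (at 0)"
  proof (rule has_vector_derivative_transform_within_open[OF _ op])
    show "0 \<in> {t \<in> {-\<epsilon><..<\<epsilon>}. \<gamma> t \<in> V}"
      using \<gamma>(1,3) q(1) by simp
    show "(h \<circ> g \<circ> inv_into V k) ((k \<circ> \<gamma>) t) = (h \<circ> (g \<circ> \<gamma>)) t"
      if "t \<in> {t \<in> {-\<epsilon><..<\<epsilon>}. \<gamma> t \<in> V}" for t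
      using that by (simp add: inv_chart[OF Y V])
  qed
  then show ?thesis
    unfolding tangent_vectors_def using sm \<gamma>(1,3)
    by (intro CollectI exI[of _ "g \<circ> \<gamma>"] exI[of _ \<epsilon>]) simp
qed

text \<open>At corresponding points the coordinate derivative \<open>?E\<close> of \<open>f\<close>
  is a left inverse of the coordinate derivative \<open>?D\<close> of \<open>g\<close>. The identity
  for \<open>f\<close>, evaluated at \<open>?D u\<close> and \<open>?D v\<close>, is then the
  identity for \<open>g\<close> read backwards.\<close>

lemma preserves_form_inverse:
  assumes "preserves_form X \<omega> Y \<eta> f"
  shows "preserves_form Y \<eta> X \<omega> g"
proof -
  have "\<eta> (V, k) (k q) u v =
      \<omega> (U, h) (h (g q)) (frechet_derivative (h \<circ> g \<circ> inv_into V k) (at (k q)) u)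
                         (frechet_derivative (h \<circ> g \<circ> inv_into V k) (at (k q)) v)"
    if U: "(U, h) \<in> atlas X" and V: "(V, k) \<in> atlas Y" and q: "q \<in> V" "g q \<in> U" for U h V k q u v
  proof -
    have q_in: "q \<in> topspace (mtop Y)"
      using q(1) chartedD(5)[OF Y V] by blast
    let ?\<phi> = "h \<circ> g \<circ> inv_into V k" and ?\<psi> = "k \<circ> f \<circ> inv_into U h"
    let ?D = "frechet_derivative ?\<phi> (at (k q))" and ?E = "frechet_derivative ?\<psi> (at (h (g q)))"
    have D: "(?\<phi> has_derivative ?D) (at (k q))"
      by (rule coordinate_derivative[OF U V q])
    have "?\<phi> (k q) = h (g q)"
      by (simp add: inv_chart[OF Y V q(1)])
    moreover have "(?\<psi> has_derivative ?E) (at (h (g q)))"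
      using coordinate_map_differentiable[OF X Y f openin_topspace U V g_in[OF q_in] q(2)] q(1)
      by (simp add: fg[OF q_in] frechet_derivative_works)
    ultimately have "((\<lambda>x. ?\<psi> (?\<phi> x)) has_derivative (\<lambda>x. ?E (?D x))) (at (k q))"
      using has_derivative_compose[OF D] by metis
    \<comment> \<open>The composite is seen to be the identity on the coordinate image of
      \<open>?B\<close>; this set is open and contains \<open>k q\<close>, which determines the
      derivative.\<close>
    moreover have "((\<lambda>x. ?\<psi> (?\<phi> x)) has_derivative (\<lambda>x. x)) (at (k q))"
    proof -
      let ?B = "{r \<in> V. g r \<in> U}"
      have "openin (mtop Y) ?B"
        using homeo chartedD(1)[OF Y V] chartedD(1)[OF X U]
        by (intro openin_continuous_map_preimage_gen) (auto simp: homeomorphic_maps_def)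
      then have "open (k ` ?B)"
        by (intro chart_image_open[OF Y V]) auto
      then show ?thesis
      proof (rule has_derivative_transform_within_open[OF has_derivative_ident])
        show "k q \<in> k ` ?B"
          using q by auto
        fix x assume "x \<in> k ` ?B"
        then obtain r where r: "r \<in> V" "g r \<in> U" "x = k r"
          by auto
        moreover have "f (g r) = r"
          using r(1) chartedD(5)[OF Y V] fg by blast
        ultimately show "x = ?\<psi> (?\<phi> x)"
          by (simp add: inv_chart[OF Y V] inv_chart[OF X U])
      qed
    qed
    ultimately have "(\<lambda>x. ?E (?D x)) = (\<lambda>x. x)"
      by (rule has_derivative_unique)
    then have ED: "?E (?D x) = x" for x
      by (rule fun_cong)
    have "f (g q) \<in> V"
      using q(1) fg[OF q_in] by simp
    from preserves_formD[OF assms U V q(2) this, of "?D u" "?D v"]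
    show ?thesis
      by (simp only: ED fg[OF q_in])
  qed
  then show ?thesis
    unfolding preserves_form_def by blast
qed

end

lemma manifold_equivalence_sym:
  assumes "manifold_equivalence X Y f g"
  shows "manifold_equivalence Y X g f"
proof -
  interpret manifold_equivalence X Y f g
    by (rule assms)
  show ?thesis
    by unfold_locales (use X Y f g gf fg in auto)
qed

lemma symplectomorphismE:
  assumes "smooth_manifold X" "smooth_manifold Y" "symplectomorphism X \<omega> Y \<eta> f"
  obtains g where "manifold_equivalence X Y f g" "preserves_form X \<omega> Y \<eta> f"
    "preserves_form Y \<eta> X \<omega> g"
proof -
  obtain g where g: "smooth_between X (topspace (mtop X)) Y (topspace (mtop Y)) f"
    "smooth_between Y (topspace (mtop Y)) X (topspace (mtop X)) g"
    "\<forall>x\<in>topspace (mtop X). g (f x) = x" "\<forall>y\<in>topspace (mtop Y). f (g y) = y"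
    using assms(3) unfolding symplectomorphism_def diffeo_between_iff by blast
  then interpret manifold_equivalence X Y f g
    using assms(1,2) by unfold_locales (auto simp: smooth_manifold_charted)
  have "preserves_form X \<omega> Y \<eta> f"
    using assms(3) by (simp add: symplectomorphism_def preserves_form_def)
  then show ?thesis
    using that manifold_equivalence_axioms preserves_form_inverse by blast
qed

text \<open>Preservation is stated for \<open>g\<close> because the Lagrangian condition on f(S) is
  tested on tangent vectors in \<open>Y\<close>: \<open>g\<close> moves them to tangent vectors of
  \<open>S\<close>, on which \<open>\<omega>\<close> is known to vanish.\<close>

locale symplectic_equivalence = manifold_equivalence X Y f g
  for X :: "('a, real^4) manifold" and Y :: "('b, real^4) manifold" and f g +
  fixes \<omega> :: "('a, real^4) form2" and \<eta> :: "('b, real^4) form2"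
  assumes pres: "preserves_form Y \<eta> X \<omega> g"
begin

lemma embedded_torus_transport:
  assumes "embedded_torus X S"
  shows "embedded_torus Y (f ` S)"
proof -
  obtain \<iota> where S: "S \<subseteq> topspace (mtop X)"
    and \<iota>: "diffeo_between (euclidean_manifold :: (complex \<times> complex, _) manifold)
            (sphere 0 1 \<times> sphere 0 1) X S \<iota>"
    using assms by (auto simp: embedded_torus_def)
  have "f ` S \<subseteq> topspace (mtop Y)"
    using S f_in by blast
  then show ?thesis
    using diffeo_between_compose[OF charted_euclidean X Y \<iota> diffeo_restrict(1)[OF S]]
    by (auto simp: embedded_torus_def)
qed

lemma lagrangian_torus_transport:
  assumes "lagrangian_torus X \<omega> S"
  shows "lagrangian_torus Y \<eta> (f ` S)"
proof -
  have torus: "embedded_torus X S"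
    and lag: "\<And>U h p u v. (U, h) \<in> atlas X \<Longrightarrow> p \<in> S \<inter> U \<Longrightarrow> u \<in> tangent_vectors X (U, h) S p \<Longrightarrow>
      v \<in> tangent_vectors X (U, h) S p \<Longrightarrow> \<omega> (U, h) (h p) u v = 0"
    using assms unfolding lagrangian_torus_def by blast+
  have S: "S \<subseteq> topspace (mtop X)"
    using torus by (simp add: embedded_torus_def)
  have "\<eta> (V, k) (k q) u v = 0"
    if V: "(V, k) \<in> atlas Y" and q: "q \<in> f ` S \<inter> V"
      and u: "u \<in> tangent_vectors Y (V, k) (f ` S) q" and v: "v \<in> tangent_vectors Y (V, k) (f ` S) q"
    for V k q u v
  proof -
    have "g q \<in> S"
      using q S gf by auto
    then obtain U h where U: "(U, h) \<in> atlas X" "g q \<in> U"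
      using charted_cover[OF X] S by blast
    have qV: "q \<in> V"
      using q by blast
    show ?thesis
      unfolding preserves_formD[OF pres V U(1) qV U(2)]
      by (rule lag[OF U(1)]) (use \<open>g q \<in> S\<close> U(2) tangent_vectors_transport[OF U(1) V qV U(2) S] u v in auto)
  qed
  then show ?thesis
    using embedded_torus_transport[OF torus] unfolding lagrangian_torus_def by blast
qed

end

section \<open>Subspaces, frontiers and homology under the homeomorphism\<close>

context manifold_equivalence
begin

lemma homeo_restrict:
  assumes "S \<subseteq> topspace (mtop X)"
  shows "homeomorphic_maps (subtopology (mtop X) S) (subtopology (mtop Y) (f ` S)) f g"
proof (rule homeomorphic_maps_subtopologies[OF homeo])
  have "f ` S \<subseteq> topspace (mtop Y)"
    using assms f_in by blast
  then show "f ` (topspace (mtop X) \<inter> S) = topspace (mtop Y) \<inter> f ` S"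
    using assms by (simp add: inf_absorb2)
qed

lemma homeo_restrictD:
  assumes "S \<subseteq> topspace (mtop X)"
  shows "continuous_map (subtopology (mtop X) S) (subtopology (mtop Y) (f ` S)) f"
    "continuous_map (subtopology (mtop Y) (f ` S)) (subtopology (mtop X) S) g"
    "homeomorphic_map (subtopology (mtop Y) (f ` S)) (subtopology (mtop X) S) g"
  using homeo_restrict[OF assms] homeo_restrict[OF assms, unfolded homeomorphic_maps_map]
  unfolding homeomorphic_maps_def by blast+

text \<open>The condition on a nullhomologous framing ranges over all fundamental classes, so a
  class given on f(T) has to be brought back to \<open>T\<close>. The isomorphism induced by
  \<open>g\<close> maps generators to generators.\<close>

lemma fundamental_class_transport:
  assumes S: "S \<subseteq> topspace (mtop X)" and c: "fundamental_class (mtop Y) (f ` S) c"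
  shows "fundamental_class (mtop X) S
           (hom_induced 2 (subtopology (mtop Y) (f ` S)) {} (subtopology (mtop X) S) {} g c)"
proof -
  let ?H = "homology_group 2 (subtopology (mtop Y) (f ` S))"
  let ?G = "homology_group 2 (subtopology (mtop X) S)"
  let ?g = "hom_induced 2 (subtopology (mtop Y) (f ` S)) {} (subtopology (mtop X) S) {} g"
  have iso: "?g \<in> iso ?H ?G"
    by (rule homeomorphic_map_homology_iso[OF homeo_restrictD(3)[OF S]])
  then interpret group_hom ?H ?G ?g
    by (simp add: group_hom_def group_hom_axioms_def iso_def)
  have "?g ` carrier ?H = carrier ?G"
    using iso by (simp add: iso_def bij_betw_def)
  moreover have "generate ?G (?g ` {c}) = ?g ` generate ?H {c}"
    using c by (intro generate_img) (simp add: fundamental_class_def)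
  ultimately show ?thesis
    using c hom_closed by (simp add: fundamental_class_def)
qed

lemma frontier_transport:
  assumes "N \<subseteq> topspace (mtop X)"
  shows "mtop Y frontier_of (f ` N) = f ` (mtop X frontier_of N)"
    "topspace (mtop Y) - mtop Y interior_of (f ` N) = f ` (topspace (mtop X) - mtop X interior_of N)"
proof -
  have f: "homeomorphic_map (mtop X) (mtop Y) f"
    using homeo homeomorphic_maps_map by blast
  show "mtop Y frontier_of (f ` N) = f ` (mtop X frontier_of N)"
    by (rule homeomorphic_map_frontier_of[OF f assms])
  have "f ` (topspace (mtop X) - mtop X interior_of N) =
      f ` topspace (mtop X) - f ` (mtop X interior_of N)"
    using homeomorphic_imp_injective_map[OF f] interior_of_subset_topspace[of "mtop X" N]
    by (intro inj_on_image_set_diff) auto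
  then show "topspace (mtop Y) - mtop Y interior_of (f ` N) =
      f ` (topspace (mtop X) - mtop X interior_of N)"
    by (simp add: homeomorphic_map_interior_of[OF f assms] homeomorphic_imp_surjective_map[OF f])
qed

text \<open>The two inclusions and the two restrictions of \<open>f\<close> form a commutative
  square, both of whose composites are induced by \<open>f\<close> from \<open>?B\<close> to
  \<open>?C'\<close>. A class that dies in \<open>?C\<close> therefore has an image that dies in
  \<open>?C'\<close>.\<close>

lemma kernel_transport:
  assumes B: "B \<subseteq> C" "C \<subseteq> topspace (mtop X)"
    and z: "z \<in> kernel (homology_group n (subtopology (mtop X) B)) (homology_group n (subtopology (mtop X) C))
              (hom_induced n (subtopology (mtop X) B) {} (subtopology (mtop X) C) {} id)"
  shows "hom_induced n (subtopology (mtop X) B) {} (subtopology (mtop Y) (f ` B)) {} f z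
           \<in> kernel (homology_group n (subtopology (mtop Y) (f ` B))) (homology_group n (subtopology (mtop Y) (f ` C)))
              (hom_induced n (subtopology (mtop Y) (f ` B)) {} (subtopology (mtop Y) (f ` C)) {} id)"
proof -
  let ?B = "subtopology (mtop X) B" and ?C = "subtopology (mtop X) C"
  let ?B' = "subtopology (mtop Y) (f ` B)" and ?C' = "subtopology (mtop Y) (f ` C)"
  have z': "z \<in> carrier (homology_group n ?B)"
    "hom_induced n ?B {} ?C {} id z = \<one>\<^bsub>homology_group n ?C\<^esub>"
    using z by (auto simp: kernel_def)
  have cf: "continuous_map ?B ?B' f" "continuous_map ?C ?C' f"
    using homeo_restrictD(1)[of B] homeo_restrictD(1)[of C] B by auto
  have ci: "continuous_map ?B ?C id" "continuous_map ?B' ?C' id"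
    using B(1) by (auto simp: continuous_map_in_subtopology continuous_map_from_subtopology)
  have "hom_induced n ?B' {} ?C' {} id (hom_induced n ?B {} ?B' {} f z) = hom_induced n ?B {} ?C' {} f z"
    using hom_induced_compose'[OF cf(1) _ ci(2), of "{}" "{}" "{}" n z] by simp
  also have "\<dots> = hom_induced n ?C {} ?C' {} f (hom_induced n ?B {} ?C {} id z)"
    using hom_induced_compose'[OF ci(1) _ cf(2), of "{}" "{}" "{}" n z] by simp
  also have "\<dots> = \<one>\<^bsub>homology_group n ?C'\<^esub>"
    unfolding z'(2) by (rule hom_one[OF hom_induced_hom]) simp_all
  moreover have "hom_induced n ?B {} ?B' {} f z \<in> carrier (homology_group n ?B')"
    by (rule hom_induced_carrier)
  ultimately show ?thesis
    by (simp add: kernel_def)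
qed

end

section \<open>Transport of framings and of the difference class\<close>

context symplectic_equivalence
begin

text \<open>Precomposing with \<open>g\<close> restores the normalization on the zero section, since
  f(g(q)) = q on f(T). Leaving the disc factor alone keeps the slice parameter and the reference
  point 1 of \<open>difference_map\<close>. The bracketing follows two successive uses of
  \<open>diffeo_between_compose\<close>.\<close>

definition transport :: "('a \<times> complex \<Rightarrow> 'a) \<Rightarrow> 'b \<times> complex \<Rightarrow> 'b" where
  "transport \<phi> = f \<circ> (\<phi> \<circ> map_prod g id)"

lemma framingD:
  assumes "framing X T N \<phi>"
  shows "N \<subseteq> topspace (mtop X)" "T \<subseteq> topspace (mtop X)" "bij_betw \<phi> (T \<times> cball 0 1) N"
    "\<And>p. p \<in> T \<Longrightarrow> \<phi> (p, 0) = p"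
proof -
  show 1: "N \<subseteq> topspace (mtop X)" "bij_betw \<phi> (T \<times> cball 0 1) N" "\<And>p. p \<in> T \<Longrightarrow> \<phi> (p, 0) = p"
    using assms by (auto simp: framing_def diffeo_between_def)
  \<comment> \<open>Recovered from the zero section: each \<open>p\<close> in \<open>T\<close>
    equals \<open>\<phi> (p, 0)\<close>, which is a point of \<open>N\<close>.\<close>
  show "T \<subseteq> topspace (mtop X)"
  proof
    fix p assume p: "p \<in> T"
    then have "\<phi> (p, 0) \<in> N"
      by (intro bij_betw_apply[OF 1(2)]) auto
    then show "p \<in> topspace (mtop X)"
      using 1(1,3) p by auto
  qed
qed

lemma framing_transport:
  assumes \<phi>: "framing X T N \<phi>"
  shows "framing Y (f ` T) (f ` N) (transport \<phi>)"
proof -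
  note N = framingD(1)[OF \<phi>] and T = framingD(2)[OF \<phi>]
  let ?XE = "product_manifold X (euclidean_manifold :: (complex, _) manifold)"
  let ?YE = "product_manifold Y (euclidean_manifold :: (complex, _) manifold)"
  have cX: "charted ?XE" and cY: "charted ?YE"
    using charted_product charted_euclidean X Y by blast+
  obtain f' where f': "smooth_between Y (f ` T) X T g" "smooth_between X T Y (f ` T) f'"
    "\<forall>y\<in>f ` T. f' (g y) = y" "\<forall>x\<in>T. g (f' x) = x"
    using diffeo_restrict(2)[OF T] unfolding diffeo_between_iff by blast
  have "diffeo_between ?YE (f ` T \<times> cball 0 1) ?XE (T \<times> cball 0 1) (map_prod g id)"
    unfolding diffeo_between_iff
    by (intro exI[of _ "map_prod f' id"] conjI smooth_between_map_prod_id[OF Y f'(1)]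
        smooth_between_map_prod_id[OF X f'(2)]) (use f' in auto)
  moreover have "diffeo_between ?XE (T \<times> cball 0 1) X N \<phi>"
    using \<phi> by (simp add: framing_def)
  ultimately have "diffeo_between ?YE (f ` T \<times> cball 0 1) X N (\<phi> \<circ> map_prod g id)"
    by (rule diffeo_between_compose[OF cY cX X])
  then have "diffeo_between ?YE (f ` T \<times> cball 0 1) Y (f ` N) (transport \<phi>)"
    unfolding transport_def by (rule diffeo_between_compose[OF cY X Y _ diffeo_restrict(1)[OF N]])
  moreover have "f ` N \<subseteq> topspace (mtop Y)"
    using N f_in by blast
  moreover have "transport \<phi> (q, 0) = q" if "q \<in> f ` T" for q
    using that T gf framingD(4)[OF \<phi>] by (auto simp: transport_def subset_iff)
  ultimately show ?thesis
    by (simp add: framing_def)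
qed

lemma lagrangian_framing_transport:
  assumes \<phi>: "lagrangian_framing X \<omega> T N \<phi>"
  shows "lagrangian_framing Y \<eta> (f ` T) (f ` N) (transport \<phi>)"
proof -
  have fr: "framing X T N \<phi>"
    and lag: "\<And>x. x \<in> cball 0 1 \<Longrightarrow> lagrangian_torus X \<omega> (\<phi> ` (T \<times> {x}))"
    using \<phi> by (auto simp: lagrangian_framing_def)
  have "transport \<phi> ` (f ` T \<times> {x}) = f ` \<phi> ` (T \<times> {x})" for x
  proof -
    have "map_prod g id ` (f ` T \<times> {x}) = T \<times> {x}"
      using framingD(2)[OF fr] gf by (force simp: subset_iff)
    then show ?thesis
      by (metis transport_def image_comp)
  qed
  then show ?thesis
    using framing_transport[OF fr] lagrangian_torus_transport[OF lag]
    by (simp add: lagrangian_framing_def)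
qed

text \<open>Pushing a class along the transported framing amounts to bringing it back by
  \<open>g\<close>, pushing it along \<open>\<phi>\<close>, which lands in the kernel by hypothesis,
  and applying \<open>f\<close>. This rests on functoriality of \<open>hom_induced\<close> for
  continuous maps, hence the case distinction on continuity into the frontier.\<close>

lemma nullhomologous_framing_transport:
  assumes \<phi>: "nullhomologous_framing X T N \<phi>"
  shows "nullhomologous_framing Y (f ` T) (f ` N) (transport \<phi>)"
proof -
  have fr: "framing X T N \<phi>"
    using \<phi> by (simp add: nullhomologous_framing_def)
  note N = framingD(1)[OF fr] and T = framingD(2)[OF fr]
  let ?B = "mtop X frontier_of N" and ?C = "topspace (mtop X) - mtop X interior_of N"
  let ?b = "subtopology (mtop X) ?B" and ?c = "subtopology (mtop X) ?C"
  let ?b' = "subtopology (mtop Y) (f ` ?B)" and ?c' = "subtopology (mtop Y) (f ` ?C)"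
  let ?t = "subtopology (mtop X) T" and ?t' = "subtopology (mtop Y) (f ` T)"
  have BC: "?B \<subseteq> ?C" "?C \<subseteq> topspace (mtop X)"
    using frontier_of_subset_topspace[of "mtop X" N] by (auto simp: frontier_of_def)
  have B: "?B \<subseteq> topspace (mtop X)"
    by (rule frontier_of_subset_topspace)
  have main: "hom_induced 2 ?t' {} ?b' {} (\<lambda>q. transport \<phi> (q, x)) c
      \<in> kernel (homology_group 2 ?b') (homology_group 2 ?c') (hom_induced 2 ?b' {} ?c' {} id)"
    if x: "x \<in> sphere 0 1" and c: "fundamental_class (mtop Y) (f ` T) c" for x c
  proof (cases "continuous_map ?t ?b (\<lambda>p. \<phi> (p, x))")
    case True
    let ?d = "hom_induced 2 ?t' {} ?t {} g c"
    have ker: "hom_induced 2 ?t {} ?b {} (\<lambda>p. \<phi> (p, x)) ?d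
        \<in> kernel (homology_group 2 ?b) (homology_group 2 ?c) (hom_induced 2 ?b {} ?c {} id)"
      using \<phi> x fundamental_class_transport[OF T c] by (simp add: nullhomologous_framing_def Let_def)
    have "hom_induced 2 ?b {} ?b' {} f (hom_induced 2 ?t {} ?b {} (\<lambda>p. \<phi> (p, x)) ?d) =
        hom_induced 2 ?b {} ?b' {} f (hom_induced 2 ?t' {} ?b {} ((\<lambda>p. \<phi> (p, x)) \<circ> g) c)"
      using hom_induced_compose'[OF homeo_restrictD(2)[OF T] _ True, of "{}" "{}" "{}"] by simp
    also have "\<dots> = hom_induced 2 ?t' {} ?b' {} (f \<circ> ((\<lambda>p. \<phi> (p, x)) \<circ> g)) c"
      using hom_induced_compose'[OF continuous_map_compose[OF homeo_restrictD(2)[OF T] True] _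
          homeo_restrictD(1)[OF B], of "{}" "{}" "{}"] by simp
    also have "f \<circ> ((\<lambda>p. \<phi> (p, x)) \<circ> g) = (\<lambda>q. transport \<phi> (q, x))"
      by (auto simp: transport_def)
    finally show ?thesis
      using kernel_transport[OF BC ker] by simp
  next
    case False
    \<comment> \<open>That \<open>\<phi>\<close> maps \<open>T \<times> {x}\<close> into the frontier of \<open>N\<close> would need invariance of domain. It can be left open:
      otherwise \<open>hom_induced\<close> takes its default value, the neutral element.\<close>
    have "\<not> continuous_map ?t' ?b' (\<lambda>q. transport \<phi> (q, x))"
    proof
      assume "continuous_map ?t' ?b' (\<lambda>q. transport \<phi> (q, x))"
      \<comment> \<open>Conjugating back by the two homeomorphisms recovers the slice of
        \<open>\<phi>\<close>, so continuity downstairs would give continuity upstairs.\<close>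
      then have "continuous_map ?t ?b (g \<circ> ((\<lambda>q. transport \<phi> (q, x)) \<circ> f))"
        by (intro continuous_map_compose[OF _ homeo_restrictD(2)[OF B]]
            continuous_map_compose[OF homeo_restrictD(1)[OF T]])
      then have "continuous_map ?t ?b (\<lambda>p. \<phi> (p, x))"
      proof (rule continuous_map_eq)
        fix p assume "p \<in> topspace ?t"
        then have p: "p \<in> T"
          by simp
        then have "\<phi> (p, x) \<in> N"
          using x by (intro bij_betw_apply[OF framingD(3)[OF fr]]) auto
        then show "(g \<circ> ((\<lambda>q. transport \<phi> (q, x)) \<circ> f)) p = \<phi> (p, x)"
          using p N T gf by (auto simp: transport_def subset_iff)
      qed
      with False show False
        by blast
    qed
    then have "hom_induced 2 ?t' {} ?b' {} (\<lambda>q. transport \<phi> (q, x)) c = \<one>\<^bsub>homology_group 2 ?b'\<^esub>"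
      by (intro hom_induced_default) blast
    moreover have "hom_induced 2 ?b' {} ?c' {} id \<one>\<^bsub>homology_group 2 ?b'\<^esub> = \<one>\<^bsub>homology_group 2 ?c'\<^esub>"
      by (rule hom_one[OF hom_induced_hom]) simp_all
    moreover have "hom_induced 2 ?t' {} ?b' {} (\<lambda>q. transport \<phi> (q, x)) c \<in> carrier (homology_group 2 ?b')"
      by (rule hom_induced_carrier)
    ultimately show ?thesis
      by (simp add: kernel_def)
  qed
  show ?thesis
    unfolding nullhomologous_framing_def Let_def frontier_transport[OF N]
    using framing_transport[OF fr] main by blast
qed

text \<open>When the transported \<open>\<phi>\<^sub>0\<close> is inverted on a value of the
  transported \<open>\<phi>\<^sub>1\<close>, the outer \<open>f\<close> cancels. The base point
  \<open>p\<close> becomes \<open>f p\<close>, but the disc component \<open>z\<close>, which alone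
  is retained, does not change.\<close>

lemma difference_map_transport:
  assumes \<phi>\<^sub>0: "framing X T N \<phi>\<^sub>0" and \<phi>\<^sub>1: "framing X T N \<phi>\<^sub>1" and q: "q \<in> f ` T"
  shows "difference_map (f ` T) (transport \<phi>\<^sub>0) (transport \<phi>\<^sub>1) q = difference_map T \<phi>\<^sub>0 \<phi>\<^sub>1 (g q)"
proof -
  note T = framingD(2)[OF \<phi>\<^sub>0]
  have "g q \<in> T"
    using q T gf by auto
  then have "\<phi>\<^sub>1 (g q, 1) \<in> N"
    by (intro bij_betw_apply[OF framingD(3)[OF \<phi>\<^sub>1]]) auto
  then have y: "\<phi>\<^sub>1 (g q, 1) \<in> \<phi>\<^sub>0 ` (T \<times> cball 0 1)"
    using framingD(3)[OF \<phi>\<^sub>0] by (simp add: bij_betw_def)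
  obtain p z where pz: "inv_into (T \<times> cball 0 1) \<phi>\<^sub>0 (\<phi>\<^sub>1 (g q, 1)) = (p, z)"
    by fastforce
  then have pz': "p \<in> T" "z \<in> cball 0 1" "\<phi>\<^sub>0 (p, z) = \<phi>\<^sub>1 (g q, 1)"
    using inv_into_into[OF y] f_inv_into_f[OF y] by auto
  \<comment> \<open>Injectivity forces \<open>inv_into\<close> to select the preimage
    \<open>(f p, z)\<close>.\<close>
  have "inj_on (transport \<phi>\<^sub>0) (f ` T \<times> cball 0 1)"
    using framing_transport[OF \<phi>\<^sub>0] by (simp add: framing_def diffeo_between_def bij_betw_def)
  then have "inv_into (f ` T \<times> cball 0 1) (transport \<phi>\<^sub>0) (transport \<phi>\<^sub>1 (q, 1)) = (f p, z)"
    by (rule inv_into_f_eq) (use pz' T gf in \<open>auto simp: transport_def subset_iff\<close>)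
  then show ?thesis
    by (simp add: difference_map_def pz)
qed

text \<open>The witnesses are \<open>d \<circ> g\<close> and the unchanged \<open>\<kappa>\<close>:
  \<open>g\<close> is onto on first homology, so the subgroup of the integers, and with it
  \<open>n\<close>, stays the same.\<close>

lemma framing_value_transport:
  assumes "framing_value X \<omega> T n"
  shows "framing_value Y \<eta> (f ` T) n"
proof -
  let ?t = "subtopology (mtop X) T" and ?t' = "subtopology (mtop Y) (f ` T)"
  obtain N \<phi>\<^sub>N \<phi>\<^sub>L d \<kappa> where N: "nullhomologous_framing X T N \<phi>\<^sub>N" and L: "lagrangian_framing X \<omega> T N \<phi>\<^sub>L"
    and d: "homotopic_with (\<lambda>_. True) ?t circle (difference_map T \<phi>\<^sub>N \<phi>\<^sub>L) d"
    and \<kappa>: "\<kappa> \<in> iso (homology_group 1 circle) integer_group"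
      "\<kappa> ` hom_induced 1 ?t {} circle {} d ` carrier (homology_group 1 ?t) = {int n * k | k. True}"
    using assms unfolding framing_value_def difference_class_def by blast
  have fr: "framing X T N \<phi>\<^sub>N" "framing X T N \<phi>\<^sub>L"
    using N L by (simp_all add: nullhomologous_framing_def lagrangian_framing_def)
  note T = framingD(2)[OF fr(1)]
  have "homotopic_with (\<lambda>_. True) ?t' circle (difference_map T \<phi>\<^sub>N \<phi>\<^sub>L \<circ> g) (d \<circ> g)"
    by (rule homotopic_with_compose_continuous_map_right[OF d homeo_restrictD(2)[OF T]]) simp
  \<comment> \<open>The two difference maps are compared on f(T) only, which is the underlying set
    of \<open>?t'\<close>.\<close>
  then have "homotopic_with (\<lambda>_. True) ?t' circle
      (difference_map (f ` T) (transport \<phi>\<^sub>N) (transport \<phi>\<^sub>L)) (d \<circ> g)"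
    by (rule homotopic_with_eq) (auto simp: difference_map_transport[OF fr])
  moreover have "hom_induced 1 ?t' {} circle {} (d \<circ> g) ` carrier (homology_group 1 ?t') =
      hom_induced 1 ?t {} circle {} d ` carrier (homology_group 1 ?t)"
  proof -
    have "hom_induced 1 ?t' {} ?t {} g ` carrier (homology_group 1 ?t') = carrier (homology_group 1 ?t)"
      using homeomorphic_map_homology_iso[OF homeo_restrictD(3)[OF T], of 1]
      by (simp add: iso_def bij_betw_def)
    \<comment> \<open>Functoriality asks for continuity of \<open>d\<close>, which is part of the
      given homotopy.\<close>
    moreover have "hom_induced 1 ?t' {} circle {} (d \<circ> g) =
        hom_induced 1 ?t {} circle {} d \<circ> hom_induced 1 ?t' {} ?t {} g"
      using homotopic_with_imp_continuous_maps[OF d] homeo_restrictD(2)[OF T]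
      by (intro hom_induced_compose_empty) auto
    ultimately show ?thesis
      by (simp only: image_comp[symmetric])
  qed
  ultimately have "\<exists>d \<in> difference_class (mtop Y) (f ` T) (transport \<phi>\<^sub>N) (transport \<phi>\<^sub>L).
      \<exists>\<kappa> \<in> iso (homology_group 1 circle) integer_group.
        \<kappa> ` hom_induced 1 ?t' {} circle {} d ` carrier (homology_group 1 ?t') = {int n * k | k. True}"
    using \<kappa> unfolding difference_class_def
    by (intro bexI[of _ "d \<circ> g"] bexI[of _ \<kappa>] CollectI) simp_all
  then show ?thesis
    unfolding framing_value_def
    using nullhomologous_framing_transport[OF N] lagrangian_framing_transport[OF L] by blast
qed

end

theorem theorem3p4:
  fixes X :: "('a, real^4) manifold" and Y :: "('b, real^4) manifold"
    and \<omega> :: "('a, real^4) form2" and \<eta> :: "('b, real^4) form2"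
    and T :: "'a set" and T' :: "'b set" and f :: "'a \<Rightarrow> 'b"
  assumes "symplectic_manifold X \<omega>" and "symplectic_manifold Y \<eta>"
    and "lagrangian_torus X \<omega> T" and "nullhomologous (mtop X) T"
    and "symplectomorphism X \<omega> Y \<eta> f" and "f ` T = T'"
  shows "(\<forall>n. framing_value X \<omega> T n \<longleftrightarrow> framing_value Y \<eta> T' n) \<and>
         lagrangian_framing_invariant X \<omega> T = lagrangian_framing_invariant Y \<eta> T'"
proof -
  have man: "smooth_manifold X" "smooth_manifold Y"
    using assms(1,2) by (simp_all add: symplectic_manifold_def)
  obtain g where fg: "manifold_equivalence X Y f g" and pres: "preserves_form X \<omega> Y \<eta> f"
    "preserves_form Y \<eta> X \<omega> g"
    by (rule symplectomorphismE[OF man assms(5)])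
  interpret forward: symplectic_equivalence X Y f g \<omega> \<eta>
    using fg pres(2) by (simp add: symplectic_equivalence_def symplectic_equivalence_axioms_def)
  \<comment> \<open>Exchanging the roles of the manifolds turns the requirement on the inverse map
    into preservation of the forms by \<open>f\<close>.\<close>
  interpret backward: symplectic_equivalence Y X g f \<eta> \<omega>
    using manifold_equivalence_sym[OF fg] pres(1)
    by (simp add: symplectic_equivalence_def symplectic_equivalence_axioms_def)
  have "T \<subseteq> topspace (mtop X)"
    using assms(3) by (simp add: lagrangian_torus_def embedded_torus_def)
  \<comment> \<open>Identifies the target of the backward transport, the image of \<open>T'\<close>
    under \<open>g\<close>, with the original torus.\<close>
  then have "g ` T' = T"
    using assms(6) forward.gf by force
  then have eq: "framing_value X \<omega> T n \<longleftrightarrow> framing_value Y \<eta> T' n" for n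
    using forward.framing_value_transport[of T n] backward.framing_value_transport[of T' n] assms(6)
    by auto
  then show ?thesis
    by (simp add: lagrangian_framing_invariant_def)
qed

end
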